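(* Let $X$ be a Banach space and let $(A(t),D(A(t)))_{t\in\mathbb R}$, $(B(t),D(B(t)))_{t\in\mathbb R}$ be families of linear operators on $X$. Suppose that: (a) the non-autonomous Cauchy problem for the family $(A(t)+B(t))_{t\in\mathbb R}$ is well-posed; let $W=(W(t,s))_{t\ge s}$ be the evolution family solving it, and let its evolution semigroup $\mathcal W$ on $C_0(\mathbb R;X)$ be generated by the closure of $\mathcal C:=-\frac{d}{ds}+A(\cdot)+B(\cdot)$; (b) there are $M\ge 1$ and $\omega\in\mathbb R$ such that for every $r\in\mathbb R$ the operators $A(r)$ and $B(r)$ generate $C_0$-semigroups $(e^{tA(r)})_{t\ge0}$, $(e^{tB(r)})_{t\ge 0}$ on $X$ with $\|e^{tA(r)}\|\le Me^{\omega t}$ and $\|e^{tB(r)}\|\le Me^{\omega t}$ for all $t\ge0$, and moreover $$\sup_{s\in\mathbb R}\Bigl\|\prod_{p=n}^{1}\bigl(e^{\frac tn B(s-\frac{pt}{n})}e^{\frac tn A(s-\frac{pt}{n})}\bigr)\Bigr\|\le Me^{\omega t}\qquad\text{for all } t\ge 0,\ n\in\mathbb N;$$ (c) the maps $t\mapsto R(\lambda,A(t))x$ and $t\mapsto R(\lambda,B(t))x$ are continuous on $\mathbb R$ for all $\lambda>\omega$ and $x\in X$. Then for all $x\in X$ $$W(t,s)x=\lim_{n\to\infty}\prod_{p=0}^{n-1}\Bigl(e^{\frac{t-s}{n}B(s+\frac{p(t-s)}{n})}e^{\frac{t-s}{n}A(s+\frac{p(t-s)}{n})}\Bigr)x,$$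 locally uniformly in $s,t$ with $s\le t$.
   Context: Products are ordered: $\prod_{p=0}^{n-1}U_p:=U_{n-1}U_{n-2}\cdots U_1U_0$ and, with decreasing index, $\prod_{p=n}^{1}U_p:=U_1U_2\cdots U_n$. $R(\lambda,G)=(\lambda-G)^{-1}$. The sum $A(t)+B(t)$ has domain $D(A(t))\cap D(B(t))$. For a family $(G(t),D(G(t)))_{t\in\mathbb R}$ of linear operators on $X$, a classical solution of $(\mathrm{NCP})_{s,x}$: $u'(t)=G(t)u(t)$ $(t\ge s)$, $u(s)=x$, is a function $u\in C^1([s,\infty);X)$ with $u(t)\in D(G(t))$ and $u'(t)=G(t)u(t)$ for $t\ge s$, and $u(s)=x$. The problem is well-posed if: (i) for each $s$ the space $Y_s$ of all $y\in X$ such that $(\mathrm{NCP})_{s,y}$ has a classical solution is dense in $X$ (and contained in $D(G(s))$); (ii) for $y\in Y_s$ the solution $u_s(\cdot,y)$ is unique; (iii) if $s_n\to s$, $Y_{s_n}\ni y_n\to y\in Y_s$, then $\hat u_{s_n}(t,y_n)\to\hat u_s(t,y)$ uniformly for $t$ in compact subsets of $\mathbb R$, where $\hat u_r(t,y)=u_r(t,y)$ if $t\ge r$ and $=y$ if $t<r$; (iv) there are $M\ge1,\omega\in\mathbb R$ with $\|u_s(t,y)\|\le Me^{\omega(t-s)}\|y\|$ for all $y\in Y_s$, $t\ge s$. An (exponentially bounded) evolution family is a family $(U(t,s))_{t\ge s}$ in $\mathcal L(X)$ with $U(t,r)U(r,s)=U(t,s)$, $U(t,t)=I$ for $t\ge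 r\ge s$, $(t,s)\mapsto U(t,s)$ strongly continuous, and $\|U(t,s)\|\le Me^{\omega(t-s)}$ for some $M\ge 1$, $\omega\in\mathbb R$. It solves the problem if for every $s$ the set of $y\in X$ for which $t\mapsto U(t,s)y$ is a classical solution of $(\mathrm{NCP})_{s,y}$ is dense in $X$. Well-posedness is equivalent to the existence of a unique evolution family solving the problem; it satisfies $U(t,s)y=u_s(t,y)$ for $y\in Y_s$. $C_0(\mathbb R;X)$ is the space of continuous functions $\mathbb R\to X$ vanishing at infinity, with sup norm. The evolution semigroup of an evolution family $U$ is the $C_0$-semigroup $(\mathcal T(t)f)(s)=U(s,s-t)f(s-t)$ on $C_0(\mathbb R;X)$. The multiplication operator $A(\cdot)$ on $C_0(\mathbb R;X)$ has domain $D(A(\cdot))=\{f\in C_0(\mathbb R;X): f(s)\in D(A(s))\ \forall s,\ [s\mapsto A(s)f(s)]\in C_0(\mathbb R;X)\}$ and $(A(\cdot)f)(s)=A(s)f(s)$; likewise $B(\cdot)$. The operator $-\frac{d}{ds}$ has domain $\{f\in C^1(\mathbb R;X): f,f'\in C_0(\mathbb R;X)\}$, and $\mathcal C$ has domain $D(-\frac{d}{ds})\cap D(A(\cdot))\cap D(B(\cdot))$. *)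

theory Defs
  imports "HOL-Analysis.Analysis"
begin

section \<open>The Banach space of continuous functions on the line vanishing at infinity\<close>

definition C0 :: "(real \<Rightarrow> 'a::real_normed_vector) set" where
  "C0 = {f. continuous_on UNIV f \<and> (f \<longlongrightarrow> 0) at_infinity}"

typedef (overloaded) 'a c0 = "C0 :: (real \<Rightarrow> 'a::real_normed_vector) set"
  morphisms apply_c0 Abs_c0
  by (rule exI[of _ "\<lambda>_. 0"]) (simp add: C0_def)

lemma c0_eqI: "(\<And>s. apply_c0 f s = apply_c0 g s) \<Longrightarrow> f = g"
  by (simp add: apply_c0_inject[symmetric] fun_eq_iff)

lemma apply_Abs_c0: "f \<in> C0 \<Longrightarrow> apply_c0 (Abs_c0 f) = f"
  by (rule Abs_c0_inverse)

lemma C0_bounded: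
  fixes f :: "real \<Rightarrow> 'a::real_normed_vector"
  assumes "f \<in> C0"
  shows "bounded (range f)"
proof -
  have cont: "continuous_on UNIV f" and lim: "(f \<longlongrightarrow> 0) at_infinity"
    using assms by (auto simp: C0_def)
  from tendstoD[OF lim zero_less_one]
  obtain b where b: "\<And>s. b \<le> norm s \<Longrightarrow> dist (f s) 0 < 1"
    by (auto simp: eventually_at_infinity)
  have "compact (f ` cball 0 b)"
    by (intro compact_continuous_image continuous_on_subset[OF cont]) auto
  then have "bounded (f ` cball 0 b \<union> cball 0 1)"
    by (simp add: compact_imp_bounded)
  moreover have "range f \<subseteq> f ` cball 0 b \<union> cball 0 1"
  proof safe
    fix s assume "f s \<notin> cball 0 1"
    then have "\<not> b \<le> norm s" using b[of s] by (auto simp: dist_commute)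
    then show "f s \<in> f ` cball 0 b" by auto
  qed
  ultimately show ?thesis by (rule bounded_subset)
qed

lemma C0_zero: "(\<lambda>_. 0) \<in> C0"
  and C0_add: "f \<in> C0 \<Longrightarrow> g \<in> C0 \<Longrightarrow> (\<lambda>s. f s + g s) \<in> C0"
  and C0_diff: "f \<in> C0 \<Longrightarrow> g \<in> C0 \<Longrightarrow> (\<lambda>s. f s - g s) \<in> C0"
  and C0_minus: "f \<in> C0 \<Longrightarrow> (\<lambda>s. - f s) \<in> C0"
  by (auto simp: C0_def intro!: continuous_intros tendsto_eq_intros)

lemma C0_scaleR: "f \<in> C0 \<Longrightarrow> (\<lambda>s. c *\<^sub>R f s) \<in> C0"
  unfolding C0_def
  by (auto intro!: continuous_intros tendsto_eq_intros)

instantiation c0 :: (real_normed_vector) real_vector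
begin

definition zero_c0 :: "'a c0" where "0 = Abs_c0 (\<lambda>_. 0)"
definition plus_c0 :: "'a c0 \<Rightarrow> 'a c0 \<Rightarrow> 'a c0" where
  "f + g = Abs_c0 (\<lambda>s. apply_c0 f s + apply_c0 g s)"
definition minus_c0 :: "'a c0 \<Rightarrow> 'a c0 \<Rightarrow> 'a c0" where
  "f - g = Abs_c0 (\<lambda>s. apply_c0 f s - apply_c0 g s)"
definition uminus_c0 :: "'a c0 \<Rightarrow> 'a c0" where
  "- f = Abs_c0 (\<lambda>s. - apply_c0 f s)"
definition scaleR_c0 :: "real \<Rightarrow> 'a c0 \<Rightarrow> 'a c0" where
  "c *\<^sub>R f = Abs_c0 (\<lambda>s. c *\<^sub>R apply_c0 f s)"
lemma apply_c0_simps [simp]: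
  "apply_c0 (0 :: 'a c0) = (\<lambda>_. 0)"
  "apply_c0 (f + g) = (\<lambda>s. apply_c0 f s + apply_c0 g s)"
  "apply_c0 (f - g) = (\<lambda>s. apply_c0 f s - apply_c0 g s)"
  "apply_c0 (- f) = (\<lambda>s. - apply_c0 f s)"
  "apply_c0 (c *\<^sub>R f) = (\<lambda>s. c *\<^sub>R apply_c0 f s)"
  by (simp_all add: zero_c0_def plus_c0_def minus_c0_def uminus_c0_def scaleR_c0_def apply_Abs_c0
      C0_zero C0_add C0_diff C0_minus C0_scaleR apply_c0)

instance
proof
  fix f g h :: "'a c0" and a b :: real
  show "f + g + h = f + (g + h)" "f + g = g + f" "0 + f = f" "- f + f = 0" "f - g = f + - g"
    "a *\<^sub>R (f + g) = a *\<^sub>R f + a *\<^sub>R g" "(a + b) *\<^sub>R f = a *\<^sub>R f + b *\<^sub>R f"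
    "a *\<^sub>R b *\<^sub>R f = (a * b) *\<^sub>R f" "1 *\<^sub>R f = f"
    by (auto intro!: c0_eqI simp: algebra_simps)
qed

end

instantiation c0 :: (real_normed_vector) real_normed_vector
begin

definition norm_c0 :: "'a c0 \<Rightarrow> real" where
  "norm f = (SUP s. norm (apply_c0 f s))"
definition sgn_c0 :: "'a c0 \<Rightarrow> 'a c0" where
  "sgn (f :: 'a c0) = f /\<^sub>R norm f"
definition dist_c0 :: "'a c0 \<Rightarrow> 'a c0 \<Rightarrow> real" where
  "dist (f :: 'a c0) g = norm (f - g)"
definition uniformity_c0 :: "('a c0 \<times> 'a c0) filter" where
  "uniformity_c0 = (INF e\<in>{0<..}. principal {(x :: 'a c0, y). dist x y < e})"
definition open_c0 :: "'a c0 set \<Rightarrow> bool" where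
  "open_c0 (S :: 'a c0 set) = (\<forall>x\<in>S. \<forall>\<^sub>F (x', y) in uniformity. x' = x \<longrightarrow> y \<in> S)"

lemma norm_apply_c0_le: "norm (apply_c0 f s) \<le> norm f"
proof -
  have "bdd_above (range (\<lambda>s. norm (apply_c0 f s)))"
    using C0_bounded[OF apply_c0[of f]]
    by (auto simp: bounded_iff bdd_above_def)
  then show ?thesis unfolding norm_c0_def by (intro cSUP_upper) auto
qed

lemma norm_c0_leI: "(\<And>s. norm (apply_c0 f s) \<le> b) \<Longrightarrow> norm f \<le> b"
  unfolding norm_c0_def by (intro cSUP_least) auto

instance
proof
  fix f g :: "'a c0" and a :: real
  show "dist f g = norm (f - g)" by (rule dist_c0_def)
  show "sgn f = f /\<^sub>R norm f" by (rule sgn_c0_def)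
  show "(norm f = 0) = (f = 0)"
  proof
    assume "norm f = 0"
    then show "f = 0" using norm_apply_c0_le[of f] by (intro c0_eqI) simp
  qed (simp add: norm_c0_def)
  show "norm (f + g) \<le> norm f + norm g"
    by (rule norm_c0_leI) (simp add: norm_triangle_le add_mono norm_apply_c0_le)
  have le: "norm (c *\<^sub>R k) \<le> \<bar>c\<bar> * norm k" for c and k :: "'a c0"
    by (rule norm_c0_leI) (simp add: mult_left_mono norm_apply_c0_le)
  show "norm (a *\<^sub>R f) = \<bar>a\<bar> * norm f"
  proof (cases "a = 0")
    case True
    then show ?thesis
      by (simp add: norm_c0_def)
  next
    case False
    have "inverse a *\<^sub>R a *\<^sub>R f = f"
      using False by (intro c0_eqI) simp
    then have "norm f \<le> \<bar>inverse a\<bar> * norm (a *\<^sub>R f)"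
      using le[of "inverse a" "a *\<^sub>R f"] by simp
    then have "\<bar>a\<bar> * norm f \<le> norm (a *\<^sub>R f)"
      using False by (simp add: field_simps)
    then show ?thesis using le[of a f] by simp
  qed
qed (rule uniformity_c0_def open_c0_def)+

end

declare [[coercion "apply_c0 :: 'a::real_normed_vector c0 \<Rightarrow> real \<Rightarrow> 'a"]]

lemma uniform_limit_c0:
  fixes f :: "nat \<Rightarrow> 'a::real_normed_vector c0"
  assumes "uniform_limit UNIV (\<lambda>n. apply_c0 (f n)) l sequentially"
  shows "l \<in> C0" and "f \<longlonglongrightarrow> Abs_c0 l"
proof -
  have "continuous_on UNIV l"
    using apply_c0[of "f _"]
    by (intro uniform_limit_theorem[OF _ assms] always_eventually allI) (simp_all add: C0_def)
  moreover have "(l \<longlongrightarrow> 0) at_infinity"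
  proof (rule tendstoI)
    fix e :: real assume "e > 0"
    then have "\<forall>\<^sub>F n in sequentially. \<forall>s\<in>UNIV. dist (f n s) (l s) < e / 2"
      by (intro uniform_limitD[OF assms]) simp
    then obtain n where n: "\<And>s. dist (f n s) (l s) < e / 2"
      by (auto simp: eventually_sequentially)
    have "(f n \<longlongrightarrow> 0) at_infinity" using apply_c0[of "f n"] by (simp add: C0_def)
    then have "\<forall>\<^sub>F s in at_infinity. dist (f n s) 0 < e / 2"
      using \<open>e > 0\<close> by (intro tendstoD) auto
    then show "\<forall>\<^sub>F s in at_infinity. dist (l s) 0 < e"
      by eventually_elim (metis dist_commute dist_triangle_half_l n)
  qed
  ultimately show l: "l \<in> C0" by (simp add: C0_def)
  show "f \<longlonglongrightarrow> Abs_c0 l"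
  proof (rule tendstoI)
    fix e :: real assume "e > 0"
    then have "\<forall>\<^sub>F n in sequentially. \<forall>s\<in>UNIV. dist (f n s) (l s) < e / 2"
      by (intro uniform_limitD[OF assms]) simp
    then show "\<forall>\<^sub>F n in sequentially. dist (f n) (Abs_c0 l) < e"
    proof eventually_elim
      case (elim n)
      then have "norm (f n - Abs_c0 l) \<le> e / 2"
        by (intro norm_c0_leI) (auto simp: apply_Abs_c0[OF l] dist_norm less_imp_le)
      then show ?case using \<open>e > 0\<close> by (simp add: dist_norm)
    qed
  qed
qed

instance c0 :: (banach) banach
proof
  fix f :: "nat \<Rightarrow> 'a c0"
  assume "Cauchy f"
  have "uniformly_Cauchy_on UNIV (\<lambda>n. apply_c0 (f n))"
  proof (rule uniformly_Cauchy_onI)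
    fix e :: real assume "e > 0"
    then obtain M where M: "\<And>m n. m \<ge> M \<Longrightarrow> n \<ge> M \<Longrightarrow> dist (f m) (f n) < e"
      using \<open>Cauchy f\<close> by (meson metric_CauchyD)
    have "dist (f m s) (f n s) \<le> dist (f m) (f n)" for m n s
      using norm_apply_c0_le[of "f m - f n" s] by (simp add: dist_norm)
    then show "\<exists>M. \<forall>s\<in>UNIV. \<forall>m\<ge>M. \<forall>n\<ge>M. dist (f m s) (f n s) < e"
      using M by (intro exI[of _ M] ballI allI impI) (rule le_less_trans)
  qed
  then have "uniformly_convergent_on UNIV (\<lambda>n. apply_c0 (f n))"
    by (rule Cauchy_uniformly_convergent)
  then show "convergent f"
    using uniform_limit_c0(2) by (auto simp: uniformly_convergent_on_def convergent_def)
qed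

section \<open>Linear operators and strongly continuous semigroups\<close>

text \<open>A (possibly unbounded) linear operator is given by its domain \<open>D\<close> together with a function
  whose values outside \<open>D\<close> are irrelevant.\<close>

definition linear_operator :: "'a::real_vector set \<Rightarrow> ('a \<Rightarrow> 'a) \<Rightarrow> bool" where
  "linear_operator D A \<longleftrightarrow> subspace D \<and>
     (\<forall>x\<in>D. \<forall>y\<in>D. A (x + y) = A x + A y) \<and> (\<forall>c. \<forall>x\<in>D. A (c *\<^sub>R x) = c *\<^sub>R A x)"

definition op_graph :: "'a set \<Rightarrow> ('a \<Rightarrow> 'a) \<Rightarrow> ('a \<times> 'a) set" where
  "op_graph D A = {(x, A x) | x. x \<in> D}"

text \<open>\<open>R(\<lambda>,A) = (\<lambda> - A)\<inverse>\<close>; meaningful when \<open>\<lambda> - A\<close> maps \<open>D\<close> bijectively onto the space.\<close>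

definition resolvent :: "real \<Rightarrow> 'a::real_vector set \<Rightarrow> ('a \<Rightarrow> 'a) \<Rightarrow> 'a \<Rightarrow> 'a" where
  "resolvent l D A = the_inv_into D (\<lambda>y. l *\<^sub>R y - A y)"

text \<open>Semigroups are indexed by \<open>real\<close>; only the values at nonnegative times are relevant.\<close>

definition C0_semigroup :: "(real \<Rightarrow> 'a::real_normed_vector \<Rightarrow>\<^sub>L 'a) \<Rightarrow> bool" where
  "C0_semigroup T \<longleftrightarrow> T 0 = id_blinfun \<and>
     (\<forall>t\<ge>0. \<forall>s\<ge>0. T (t + s) = T t o\<^sub>L T s) \<and>
     (\<forall>x. continuous_on {0..} (\<lambda>t. T t x))"

definition generator_graph :: "(real \<Rightarrow> 'a::real_normed_vector \<Rightarrow>\<^sub>L 'a) \<Rightarrow> ('a \<times> 'a) set" where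
  "generator_graph T = {(x, y). ((\<lambda>h. (T h x - x) /\<^sub>R h) \<longlongrightarrow> y) (at_right 0)}"

definition generates ::
  "'a::real_normed_vector set \<Rightarrow> ('a \<Rightarrow> 'a) \<Rightarrow> (real \<Rightarrow> 'a \<Rightarrow>\<^sub>L 'a) \<Rightarrow> bool" where
  "generates D A T \<longleftrightarrow> C0_semigroup T \<and> op_graph D A = generator_graph T"

section \<open>Nonautonomous Cauchy problems and evolution families\<close>

definition classical_solution ::
  "(real \<Rightarrow> 'a::real_normed_vector set) \<Rightarrow> (real \<Rightarrow> 'a \<Rightarrow> 'a) \<Rightarrow> real \<Rightarrow> 'a \<Rightarrow> (real \<Rightarrow> 'a) \<Rightarrow> bool" where
  "classical_solution D G s x u \<longleftrightarrow>
     (\<exists>u'. continuous_on {s..} u' \<and>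
        (\<forall>t\<ge>s. (u has_vector_derivative u' t) (at t within {s..}) \<and>
                u t \<in> D t \<and> u' t = G t (u t))) \<and>
     u s = x"

definition solvable_data ::
  "(real \<Rightarrow> 'a::real_normed_vector set) \<Rightarrow> (real \<Rightarrow> 'a \<Rightarrow> 'a) \<Rightarrow> real \<Rightarrow> 'a set" where
  "solvable_data D G s = {y. \<exists>u. classical_solution D G s y u}"

definition extend_left :: "real \<Rightarrow> 'a \<Rightarrow> (real \<Rightarrow> 'a) \<Rightarrow> real \<Rightarrow> 'a" where
  "extend_left s y u t = (if s \<le> t then u t else y)"

definition well_posed ::
  "(real \<Rightarrow> 'a::real_normed_vector set) \<Rightarrow> (real \<Rightarrow> 'a \<Rightarrow> 'a) \<Rightarrow> bool" where
  "well_posed D G \<longleftrightarrow>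
     (\<forall>s. closure (solvable_data D G s) = UNIV \<and> solvable_data D G s \<subseteq> D s) \<and>
     (\<forall>s y u v. classical_solution D G s y u \<longrightarrow> classical_solution D G s y v \<longrightarrow>
        (\<forall>t\<ge>s. u t = v t)) \<and>
     (\<forall>\<sigma> s \<eta> y \<upsilon> u. \<sigma> \<longlonglongrightarrow> s \<longrightarrow> \<eta> \<longlonglongrightarrow> y \<longrightarrow>
        (\<forall>n. classical_solution D G (\<sigma> n) (\<eta> n) (\<upsilon> n)) \<longrightarrow> classical_solution D G s y u \<longrightarrow>
        (\<forall>K. compact K \<longrightarrow>
           uniform_limit K (\<lambda>n. extend_left (\<sigma> n) (\<eta> n) (\<upsilon> n)) (extend_left s y u) sequentially)) \<and>
     (\<exists>M \<omega>. 1 \<le> M \<and> (\<forall>s y u. classical_solution D G s y u \<longrightarrow>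
        (\<forall>t\<ge>s. norm (u t) \<le> M * exp (\<omega> * (t - s)) * norm y)))"

text \<open>Only the values \<open>U t s\<close> with \<open>s \<le> t\<close> are relevant.\<close>

definition evolution_family :: "(real \<Rightarrow> real \<Rightarrow> 'a::real_normed_vector \<Rightarrow>\<^sub>L 'a) \<Rightarrow> bool" where
  "evolution_family U \<longleftrightarrow>
     (\<forall>t r s. s \<le> r \<and> r \<le> t \<longrightarrow> U t r o\<^sub>L U r s = U t s) \<and>
     (\<forall>t. U t t = id_blinfun) \<and>
     (\<forall>x. continuous_on {(t, s). s \<le> t} (\<lambda>(t, s). U t s x)) \<and>
     (\<exists>M \<omega>. 1 \<le> M \<and> (\<forall>t s. s \<le> t \<longrightarrow> norm (U t s) \<le> M * exp (\<omega> * (t - s))))"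

definition solves_NCP :: "(real \<Rightarrow> real \<Rightarrow> 'a::real_normed_vector \<Rightarrow>\<^sub>L 'a) \<Rightarrow>
    (real \<Rightarrow> 'a set) \<Rightarrow> (real \<Rightarrow> 'a \<Rightarrow> 'a) \<Rightarrow> bool" where
  "solves_NCP U D G \<longleftrightarrow>
     (\<forall>s. closure {y. classical_solution D G s y (\<lambda>t. U t s y)} = UNIV)"

section \<open>Evolution semigroups and operators on the function space\<close>

definition evolution_semigroup ::
  "(real \<Rightarrow> real \<Rightarrow> 'a::real_normed_vector \<Rightarrow>\<^sub>L 'a) \<Rightarrow> real \<Rightarrow> 'a c0 \<Rightarrow>\<^sub>L 'a c0" where
  "evolution_semigroup U t = Blinfun (\<lambda>f. Abs_c0 (\<lambda>s. U s (s - t) (apply_c0 f (s - t))))"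

lemma evolution_semigroup_C0:
  fixes U :: "real \<Rightarrow> real \<Rightarrow> 'a::real_normed_vector \<Rightarrow>\<^sub>L 'a"
  assumes U: "evolution_family U" and t: "0 \<le> t" and f: "f \<in> C0"
  shows "(\<lambda>s. U s (s - t) (f (s - t))) \<in> C0"
proof -
  obtain M w where "1 \<le> M" and bd: "\<And>t s. s \<le> t \<Longrightarrow> norm (U t s) \<le> M * exp (w * (t - s))"
    using U unfolding evolution_family_def by blast
  define K where "K = M * exp (w * t)"
  have K: "norm (U s (s - t)) \<le> K" for s
    using bd[of "s - t" s] t by (simp add: K_def)
  have est: "norm (U s (s - t) z) \<le> K * norm z" for s z
    by (rule order_trans[OF norm_blinfun mult_right_mono[OF K norm_ge_zero]])
  have fc: "continuous_on UNIV f" and fl: "(f \<longlongrightarrow> 0) at_infinity"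
    using f by (auto simp: C0_def)
  have Uc: "continuous_on UNIV (\<lambda>s. U s (s - t) x)" for x
  proof -
    have 1: "continuous_on {(t, s). s \<le> t} (\<lambda>(t, s). U t s x)"
      using U unfolding evolution_family_def by blast
    have 2: "continuous_on UNIV (\<lambda>s. (s, s - t))"
      by (intro continuous_on_Pair continuous_on_diff continuous_on_id continuous_on_const)
    have 3: "range (\<lambda>s. (s, s - t)) \<subseteq> {(t, s). s \<le> t}"
      using t by auto
    from continuous_on_compose2[OF 1 2 3] show ?thesis
      by simp
  qed
  have "isCont (\<lambda>s. U s (s - t) (f (s - t))) a" for a
  proof -
    have "((\<lambda>s. f (s - t)) \<longlongrightarrow> f (a - t)) (at a)"
      using fc
      by (intro isCont_tendsto_compose[where g = f, OF _ tendsto_diff[OF tendsto_ident_at tendsto_const]])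
        (simp add: continuous_on_eq_continuous_at)
    then have "((\<lambda>s. K * norm (f (s - t) - f (a - t))) \<longlongrightarrow> K * norm (f (a - t) - f (a - t))) (at a)"
      by (intro tendsto_mult tendsto_norm tendsto_diff tendsto_const)
    then have "((\<lambda>s. K * norm (f (s - t) - f (a - t))) \<longlongrightarrow> 0) (at a)"
      by simp
    then have 1: "((\<lambda>s. U s (s - t) (f (s - t) - f (a - t))) \<longlongrightarrow> 0) (at a)"
      by (rule Lim_null_comparison[OF always_eventually, rotated]) (rule allI, rule est)
    have 2: "((\<lambda>s. U s (s - t) (f (a - t))) \<longlongrightarrow> U a (a - t) (f (a - t))) (at a)"
      using Uc[of "f (a - t)"] unfolding continuous_on_def by simp
    from tendsto_add[OF 1 2] show ?thesis
      by (simp add: isCont_def blinfun.diff_right)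
  qed
  moreover have "((\<lambda>s. U s (s - t) (f (s - t))) \<longlongrightarrow> 0) at_infinity"
  proof -
    have "filterlim (\<lambda>s. s - t) at_infinity at_infinity"
      using tendsto_add_filterlim_at_infinity'[OF filterlim_ident tendsto_const[of "- t"]]
      by simp
    then have "((\<lambda>s. f (s - t)) \<longlongrightarrow> 0) at_infinity"
      by (rule filterlim_compose[OF fl])
    then have "((\<lambda>s. K * norm (f (s - t))) \<longlongrightarrow> 0) at_infinity"
      by (intro tendsto_mult_right_zero tendsto_norm_zero)
    then show ?thesis
      by (rule Lim_null_comparison[OF always_eventually, rotated]) (rule allI, rule est)
  qed
  ultimately show ?thesis by (simp add: C0_def continuous_on_eq_continuous_at)
qed

lemma evolution_semigroup_apply:
  fixes U :: "real \<Rightarrow> real \<Rightarrow> 'a::real_normed_vector \<Rightarrow>\<^sub>L 'a"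
  assumes U: "evolution_family U" and t: "0 \<le> t"
  shows "evolution_semigroup U t f s = U s (s - t) (f (s - t))"
proof -
  obtain M w where "1 \<le> M" and bd: "\<And>t s. s \<le> t \<Longrightarrow> norm (U t s) \<le> M * exp (w * (t - s))"
    using U unfolding evolution_family_def by blast
  have est: "norm (U s (s - t) (f (s - t))) \<le> norm f * (M * exp (w * t))" for s and f :: "'a c0"
  proof -
    have "norm (U s (s - t) (f (s - t))) \<le> norm (U s (s - t)) * norm (f (s - t))"
      by (rule norm_blinfun)
    also have "\<dots> \<le> (M * exp (w * t)) * norm f"
      using bd[of "s - t" s] t \<open>1 \<le> M\<close> by (intro mult_mono norm_apply_c0_le) auto
    finally show ?thesis by (simp add: mult.commute)
  qed
  note ap = apply_Abs_c0[OF evolution_semigroup_C0[OF U t apply_c0]]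
  have "bounded_linear (\<lambda>f. Abs_c0 (\<lambda>s. U s (s - t) (apply_c0 f (s - t))))"
  proof (rule bounded_linear_intro)
    show "norm (Abs_c0 (\<lambda>s. U s (s - t) (apply_c0 f (s - t)))) \<le> norm f * (M * exp (w * t))" for f
      by (rule norm_c0_leI) (simp add: ap est)
    show "Abs_c0 (\<lambda>s. U s (s - t) (apply_c0 (f + g) (s - t))) =
      Abs_c0 (\<lambda>s. U s (s - t) (apply_c0 f (s - t))) + Abs_c0 (\<lambda>s. U s (s - t) (apply_c0 g (s - t)))" for f g
      by (rule c0_eqI) (simp only: ap[of "f + g"], simp add: ap blinfun.add_right)
    show "Abs_c0 (\<lambda>s. U s (s - t) (apply_c0 (c *\<^sub>R f) (s - t))) =
      c *\<^sub>R Abs_c0 (\<lambda>s. U s (s - t) (apply_c0 f (s - t)))" for c f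
      by (rule c0_eqI) (simp only: ap[of "c *\<^sub>R f"], simp add: ap blinfun.scaleR_right)
  qed
  then show ?thesis
    by (simp add: evolution_semigroup_def bounded_linear_Blinfun_apply ap)
qed

definition mult_dom ::
  "(real \<Rightarrow> 'a::real_normed_vector set) \<Rightarrow> (real \<Rightarrow> 'a \<Rightarrow> 'a) \<Rightarrow> 'a c0 set" where
  "mult_dom D A = {f :: 'a c0. (\<forall>s. f s \<in> D s) \<and> (\<lambda>s. A s (f s)) \<in> C0}"

definition mult_op :: "(real \<Rightarrow> 'a::real_normed_vector \<Rightarrow> 'a) \<Rightarrow> 'a c0 \<Rightarrow> 'a c0" where
  "mult_op A f = Abs_c0 (\<lambda>s. A s (f s))"

text \<open>Continuity of the derivative is part of its membership in \<open>C0\<close>.\<close>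

definition deriv_dom :: "'a::real_normed_vector c0 set" where
  "deriv_dom = {f :: 'a c0. (\<forall>s. apply_c0 f differentiable at s) \<and> (\<lambda>s. vector_derivative f (at s)) \<in> C0}"

definition deriv_op :: "'a::real_normed_vector c0 \<Rightarrow> 'a c0" where
  "deriv_op f = Abs_c0 (\<lambda>s. vector_derivative f (at s))"

section \<open>Ordered products\<close>

text \<open>\<open>prod_increasing V n = V (n - 1) \<circ> \<dots> \<circ> V 1 \<circ> V 0\<close>\<close>

primrec prod_increasing :: "(nat \<Rightarrow> 'a::real_normed_vector \<Rightarrow>\<^sub>L 'a) \<Rightarrow> nat \<Rightarrow> 'a \<Rightarrow>\<^sub>L 'a" where
  "prod_increasing V 0 = id_blinfun"
| "prod_increasing V (Suc n) = V n o\<^sub>L prod_increasing V n"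

text \<open>\<open>prod_decreasing V n = V 1 \<circ> V 2 \<circ> \<dots> \<circ> V n\<close>\<close>

primrec prod_decreasing :: "(nat \<Rightarrow> 'a::real_normed_vector \<Rightarrow>\<^sub>L 'a) \<Rightarrow> nat \<Rightarrow> 'a \<Rightarrow>\<^sub>L 'a" where
  "prod_decreasing V 0 = id_blinfun"
| "prod_decreasing V (Suc n) = prod_decreasing V n o\<^sub>L V (Suc n)"

end

theory Submission
  imports Defs
begin

text \<open>The step operators \<open>(V(h) f)(s) = e\<^bsup>hB(s-h)\<^esup> e\<^bsup>hA(s-h)\<^esup> f(s - h)\<close> form a Chernoff
  function for the evolution semigroup of \<open>W\<close>: their powers are the ordered products, stability is
  assumed, and \<open>(V(h) g - g) / h\<close> tends to \<open>\<C> g\<close> uniformly on the line for \<open>g\<close> in the core, because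
  strong continuity of the resolvents makes \<open>e\<^bsup>hA(r)\<^esup> y(r)\<close> tend to \<open>y(r)\<close> uniformly in \<open>r\<close>.
  Since the limit semigroup is given, convergence follows without resolvent estimates by
  telescoping along a piecewise linear curve in the core that stays close to the orbit together
  with its derivative. Cutting off constants turns convergence in \<open>C\<^sub>0\<close> into locally uniform
  convergence.\<close>

text \<open>The consistency estimate holds only below a step width that depends on the core element,
  while telescoping applies it at a new point of the curve in every step. This is why the curve is
  piecewise linear: on a bounded time interval finitely many nodes determine it, the consistency
  error is linear in the core element, and so the smallest of finitely many step widths serves every
  point of the curve. The operators V(h) are never built as maps on C_0: all estimates are pointwise
  in s with constants independent of s, so no regularity of the step operators in their parameter
  has to be established first. Uniformity in t costs nothing extra, since the estimates concern
  every step h below a threshold, and h = t/n lies below it for all t in a bounded interval once n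
  is large.\<close>

section \<open>Increments with nearly constant derivative, and exponential decay\<close>

lemma vector_derivative_mean_value_ineq:
  fixes f :: "real \<Rightarrow> 'a::real_normed_vector"
  assumes "a \<le> b"
    and "\<And>s. a \<le> s \<Longrightarrow> s \<le> b \<Longrightarrow> (f has_vector_derivative f' s) (at s within {a..b})"
    and "\<And>s. a \<le> s \<Longrightarrow> s \<le> b \<Longrightarrow> norm (f' s - c) \<le> e"
  shows "norm (f b - f a - (b - a) *\<^sub>R c) \<le> e * (b - a)"
proof -
  let ?g = "\<lambda>s. f s - s *\<^sub>R c"
  have "norm (?g b - ?g a) \<le> e * norm (b - a)"
  proof (rule differentiable_bound[where S = "{a..b}" and f' = "\<lambda>s h. h *\<^sub>R (f' s - c)"])
    fix s assume s: "s \<in> {a..b}"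
    then have "(?g has_vector_derivative f' s - 1 *\<^sub>R c) (at s within {a..b})"
      by (intro has_vector_derivative_diff assms(2) derivative_eq_intros) auto
    then show "(?g has_derivative (\<lambda>h. h *\<^sub>R (f' s - c))) (at s within {a..b})"
      by (simp add: has_vector_derivative_def)
    have "norm (f' s - c) \<le> e" using assms(3) s by simp
    then have "0 \<le> e" using norm_ge_zero order_trans by blast
    then show "onorm (\<lambda>h. h *\<^sub>R (f' s - c)) \<le> e"
      using assms(3)[of s] s
      by (intro onorm_bound) (auto simp: mult.commute[of e] intro!: mult_left_mono)
  qed (use assms in auto)
  then show ?thesis using assms(1) by (simp add: algebra_simps)
qed

lemma right_difference_quotient_tendsto:
  fixes f :: "real \<Rightarrow> 'a::real_normed_vector"
  assumes "(f has_vector_derivative y) (at t within {t..t + 1})"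
  shows "((\<lambda>h. (f (t + h) - f t) /\<^sub>R h) \<longlongrightarrow> y) (at_right 0)"
proof (rule tendstoI)
  fix e :: real assume "e > 0"
  then obtain d where d: "d > 0" "\<And>r. r \<in> {t..t + 1} \<Longrightarrow> norm (r - t) < d \<Longrightarrow>
      norm (f r - f t - (r - t) *\<^sub>R y) \<le> e / 2 * norm (r - t)"
    using assms unfolding has_vector_derivative_def has_derivative_within_alt
    by (meson half_gt_zero)
  have "dist ((f (t + h) - f t) /\<^sub>R h) y < e" if h: "0 < h" "h < min d 1" for h
  proof -
    have "h *\<^sub>R ((f (t + h) - f t) /\<^sub>R h - y) = f (t + h) - f t - h *\<^sub>R y"
      using h by (simp add: algebra_simps)
    then have "h * norm ((f (t + h) - f t) /\<^sub>R h - y) = norm (f (t + h) - f t - h *\<^sub>R y)"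
      using h by (metis abs_of_pos norm_scaleR)
    also have "\<dots> \<le> h * (e / 2)" using d(2)[of "t + h"] h by (simp add: mult.commute)
    finally have "norm ((f (t + h) - f t) /\<^sub>R h - y) \<le> e / 2" using h by simp
    then show ?thesis using \<open>e > 0\<close> by (simp add: dist_norm)
  qed
  then show "\<forall>\<^sub>F h in at_right 0. dist ((f (t + h) - f t) /\<^sub>R h) y < e"
    unfolding eventually_at_right_field using d(1) by (intro exI[of _ "min d 1"]) auto
qed

lemma exp_decay_below:
  fixes a c K :: real
  assumes "a < 0" "c > 0"
  shows "\<exists>t\<ge>0. K * exp (a * t) < c"
proof -
  have "filterlim (\<lambda>t. a * t) at_bot at_top"
    using assms(1) by (intro filterlim_tendsto_neg_mult_at_bot[OF tendsto_const _ filterlim_ident])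
  then have "((\<lambda>t. K * exp (a * t)) \<longlongrightarrow> 0) at_top"
    by (intro tendsto_mult_right_zero filterlim_compose[OF exp_at_bot])
  then have "\<forall>\<^sub>F t in at_top. K * exp (a * t) < c \<and> 0 \<le> t"
    using assms(2) by (intro eventually_conj order_tendstoD(2) eventually_ge_at_top)
  then show ?thesis by (auto simp: eventually_at_top_linorder)
qed

section \<open>Strongly continuous semigroups\<close>

text \<open>The growth constants are parameters because the semigroups of a whole family indexed by
  the real line must share them.\<close>

locale exp_bounded_semigroup =
  fixes T :: "real \<Rightarrow> 'a::banach \<Rightarrow>\<^sub>L 'a" and M w :: real
  assumes semigroup: "C0_semigroup T"
    and bound: "0 \<le> t \<Longrightarrow> norm (T t) \<le> M * exp (w * t)"
begin

lemma zero_apply [simp]: "T 0 x = x"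
  using semigroup by (simp add: C0_semigroup_def)

lemma add_apply: "0 \<le> s \<Longrightarrow> 0 \<le> t \<Longrightarrow> T (s + t) x = T s (T t x)"
  using semigroup by (simp add: C0_semigroup_def)

lemma orbit_continuous: "continuous_on {0..} (\<lambda>t. T t x)"
  using semigroup by (simp add: C0_semigroup_def)

lemma bound_apply: "0 \<le> t \<Longrightarrow> norm (T t x) \<le> M * exp (w * t) * norm x"
  by (rule order_trans[OF norm_blinfun mult_right_mono[OF bound norm_ge_zero]])

lemma M_nonneg: "0 \<le> M"
  using bound[of 0] norm_ge_zero[of "T 0"] by (simp del: norm_ge_zero)

lemma local_bound: "0 \<le> t \<Longrightarrow> t \<le> b \<Longrightarrow> norm (T t x) \<le> M * exp (\<bar>w\<bar> * b) * norm x"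
proof -
  assume t: "0 \<le> t" "t \<le> b"
  have "w * t \<le> \<bar>w\<bar> * b" using t by (intro mult_mono) auto
  then have "M * exp (w * t) * norm x \<le> M * exp (\<bar>w\<bar> * b) * norm x"
    using M_nonneg by (intro mult_right_mono mult_left_mono) auto
  then show ?thesis using bound_apply[OF t(1)] by (rule order_trans[rotated])
qed

lemma generator_scaleR: "(x, y) \<in> generator_graph T \<Longrightarrow> (c *\<^sub>R x, c *\<^sub>R y) \<in> generator_graph T"
proof -
  assume "(x, y) \<in> generator_graph T"
  then have "((\<lambda>h. c *\<^sub>R ((T h x - x) /\<^sub>R h)) \<longlongrightarrow> c *\<^sub>R y) (at_right 0)"
    by (intro tendsto_intros) (simp add: generator_graph_def)
  then show ?thesis
    by (simp add: generator_graph_def blinfun.scaleR_right scaleR_right_diff_distrib mult.commute)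
qed

lemma generator_orbit:
  assumes "(x, y) \<in> generator_graph T" "0 \<le> t"
  shows "(T t x, T t y) \<in> generator_graph T"
proof -
  have "((\<lambda>h. T t ((T h x - x) /\<^sub>R h)) \<longlongrightarrow> T t y) (at_right 0)"
    using assms(1) by (intro tendsto_intros) (simp add: generator_graph_def)
  moreover have "\<forall>\<^sub>F h in at_right 0. T t ((T h x - x) /\<^sub>R h) = (T h (T t x) - T t x) /\<^sub>R h"
    using eventually_at_right_less[of "0::real"]
  proof eventually_elim
    case (elim h)
    have "T t (T h x) = T h (T t x)"
      using add_apply[of t h x] add_apply[of h t x] elim assms(2) by (simp add: add.commute)
    then show ?case by (simp add: blinfun.scaleR_right blinfun.diff_right)
  qed
  ultimately show ?thesis
    by (simp add: generator_graph_def tendsto_cong)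
qed

text \<open>Writing \<open>T b x\<close> as \<open>T a (T (b - a) x)\<close> for
  \<open>a \<le> b\<close> reduces increments on either side of \<open>t\<close> to the right
  derivative at 0: \<open>a = t\<close> gives the right one, \<open>b = t\<close> the left one. On
  the left the factor \<open>T a\<close> moves, which the local bound and the continuity of the
  orbit of \<open>y\<close> absorb.\<close>

lemma orbit_has_derivative:
  assumes xy: "(x, y) \<in> generator_graph T" and t: "0 \<le> t"
  shows "((\<lambda>t. T t x) has_vector_derivative T t y) (at t within {0..})"
  unfolding has_vector_derivative_def has_derivative_within_alt
proof (intro conjI allI impI)
  show "bounded_linear (\<lambda>h. h *\<^sub>R T t y)"
    by (rule bounded_linear_scaleR_left)
  fix e :: real assume e: "e > 0"
  \<comment> \<open>The inner \<open>t + 1\<close> covers all times within distance 1 of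
    \<open>t\<close>; the outer \<open>+ 1\<close> makes \<open>K\<close> positive, so that it can
    be divided by.\<close>
  define K where "K = M * exp (\<bar>w\<bar> * (t + 1)) + 1"
  have K: "K > 0" using M_nonneg by (simp add: K_def add_nonneg_pos)
  have Kb: "norm (T r z) \<le> K * norm z" if "0 \<le> r" "r \<le> t + 1" for r z
    by (rule order_trans[OF local_bound[OF that] mult_right_mono]) (simp_all add: K_def)
  have "\<forall>\<^sub>F h in at_right 0. dist ((T h x - x) /\<^sub>R h) y < e / (2 * K)"
    using xy e K by (intro tendstoD) (auto simp: generator_graph_def)
  then obtain d1 where d1: "d1 > 0" "\<And>h. 0 < h \<Longrightarrow> h < d1 \<Longrightarrow> dist ((T h x - x) /\<^sub>R h) y < e / (2 * K)"
    by (auto simp: eventually_at_right_field)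
  have step: "norm (T h x - x - h *\<^sub>R y) \<le> e / (2 * K) * h" if "0 \<le> h" "h < d1" for h
  proof (cases "h = 0")
    case False
    with that have h: "0 < h" by simp
    have "T h x - x - h *\<^sub>R y = h *\<^sub>R ((T h x - x) /\<^sub>R h - y)"
      using h by (simp add: algebra_simps)
    then have "norm (T h x - x - h *\<^sub>R y) = h * norm ((T h x - x) /\<^sub>R h - y)"
      using h by simp
    also have "\<dots> \<le> h * (e / (2 * K))"
      using d1(2)[OF h that(2)] h by (intro mult_left_mono) (auto simp: dist_norm)
    finally show ?thesis by (simp only: mult.commute)
  qed simp
  have "continuous (at t within {0..}) (\<lambda>t. T t y)"
    using orbit_continuous t by (auto simp: continuous_on_eq_continuous_within)
  then obtain d2 where d2: "d2 > 0" "\<And>r. 0 \<le> r \<Longrightarrow> dist r t < d2 \<Longrightarrow> dist (T r y) (T t y) < e / 2"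
    unfolding continuous_within_eps_delta using e by (metis atLeast_iff half_gt_zero)
  have main: "norm (T b x - T a x - (b - a) *\<^sub>R T t y) \<le> e * (b - a)"
    if ab: "0 \<le> a" "a \<le> b" "b - a < d1" "dist a t < d2" "a \<le> t + 1" for a b
  proof -
    have "T b x = T a (T (b - a) x)" using add_apply[of a "b - a" x] ab by simp
    then have "T b x - T a x - (b - a) *\<^sub>R T t y
        = T a (T (b - a) x - x - (b - a) *\<^sub>R y) + (b - a) *\<^sub>R (T a y - T t y)"
      by (simp add: blinfun.diff_right blinfun.scaleR_right scaleR_right_diff_distrib)
    also have "norm \<dots> \<le> K * (e / (2 * K) * (b - a)) + (b - a) * (e / 2)"
    proof (intro norm_triangle_le add_mono)
      show "norm (T a (T (b - a) x - x - (b - a) *\<^sub>R y)) \<le> K * (e / (2 * K) * (b - a))"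
        using ab K by (intro order_trans[OF Kb] mult_left_mono step) auto
      show "norm ((b - a) *\<^sub>R (T a y - T t y)) \<le> (b - a) * (e / 2)"
      proof -
        have "norm (T a y - T t y) \<le> e / 2" using d2(2)[of a] ab by (simp add: dist_norm)
        from mult_left_mono[OF this, of "b - a"] show ?thesis using ab by simp
      qed
    qed
    also have "\<dots> = e * (b - a)" using K by (simp add: field_simps)
    finally show ?thesis .
  qed
  show "\<exists>d>0. \<forall>r\<in>{0..}. norm (r - t) < d \<longrightarrow>
      norm (T r x - T t x - (r - t) *\<^sub>R T t y) \<le> e * norm (r - t)"
  proof (intro exI[of _ "min d1 (min d2 1)"] conjI ballI impI)
    fix r :: real assume r: "r \<in> {0..}" "norm (r - t) < min d1 (min d2 1)"
    show "norm (T r x - T t x - (r - t) *\<^sub>R T t y) \<le> e * norm (r - t)"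
    proof (cases "t \<le> r")
      case True
      then show ?thesis using main[of t r] r t d2 by (auto simp: dist_real_def)
    next
      case False
      then have "norm (T t x - T r x - (t - r) *\<^sub>R T t y) \<le> e * (t - r)"
        using main[of r t] r t by (auto simp: dist_real_def)
      moreover have "T t x - T r x - (t - r) *\<^sub>R T t y = - (T r x - T t x - (r - t) *\<^sub>R T t y)"
        by (simp add: algebra_simps)
      ultimately show ?thesis using False by (simp only: norm_minus_cancel) auto
    qed
  qed (use d1 d2 in auto)
qed

text \<open>The velocity of the orbit at time \<open>s\<close> is \<open>T s y\<close>. The
  reference vector \<open>c\<close> stays free: it is \<open>0\<close> for mere growth bounds,
  \<open>y\<close> for consistency, and the velocity at a nearby grid point for the curve in the
  core.\<close>

lemma orbit_increment_le:
  assumes "(x, y) \<in> generator_graph T" "0 \<le> a" "a \<le> b"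
    and "\<And>s. a \<le> s \<Longrightarrow> s \<le> b \<Longrightarrow> norm (T s y - c) \<le> e"
  shows "norm (T b x - T a x - (b - a) *\<^sub>R c) \<le> e * (b - a)"
  using assms
  by (intro vector_derivative_mean_value_ineq[where f' = "\<lambda>s. T s y"])
    (auto intro: has_vector_derivative_within_subset[OF orbit_has_derivative])

text \<open>Shifting the integral gives \<open>T h (F b) = F (b + h) - F h\<close>, so the
  difference quotient of \<open>F b\<close> splits into those of \<open>F\<close> at
  \<open>b\<close> and at 0, whose limits are \<open>T b x\<close> and \<open>T 0 x\<close>.\<close>

lemma integral_in_generator:
  assumes b: "0 \<le> b"
  shows "(integral {0..b} (\<lambda>s. T s x), T b x - x) \<in> generator_graph T"
proof -
  define F where "F b = integral {0..b} (\<lambda>s. T s x)" for b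
  have int: "(\<lambda>s. T s x) integrable_on {c..d}" if "0 \<le> c" for c d
    using that by (intro integrable_continuous_real continuous_on_subset[OF orbit_continuous]) auto
  have lim: "((\<lambda>h. (F (t + h) - F t) /\<^sub>R h) \<longlongrightarrow> T t x) (at_right 0)" if "0 \<le> t" for t
  proof (rule right_difference_quotient_tendsto)
    have "(F has_vector_derivative T t x) (at t within {0..t+1})"
      unfolding F_def using that
      by (intro integral_has_vector_derivative continuous_on_subset[OF orbit_continuous]) auto
    then show "(F has_vector_derivative T t x) (at t within {t..t+1})"
      by (rule has_vector_derivative_within_subset) (use that in auto)
  qed
  have shift: "T h (F b) = F (b + h) - F h" if h: "0 \<le> h" for h
  proof -
    have "T h (F b) = integral {0..b} (\<lambda>s. T h (T s x))"
      unfolding F_def by (rule integral_linear[OF int blinfun.bounded_linear_right, unfolded o_def, symmetric]) simp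
    also have "\<dots> = integral {0..b} (\<lambda>s. T (s + h) x)"
      by (intro integral_cong) (use h in \<open>auto simp: add_apply[symmetric] add.commute\<close>)
    also have "\<dots> = integral {h..b + h} (\<lambda>s. T s x)"
      using integral_shift_real_ivl[of h h "b + h" "\<lambda>s. T s x"] by simp
    also have "F h + \<dots> = F (b + h)"
      unfolding F_def using h b int by (intro Henstock_Kurzweil_Integration.integral_combine) auto
    finally show ?thesis by (simp add: algebra_simps)
  qed
  have "((\<lambda>h. (F (b + h) - F b) /\<^sub>R h - (F (0 + h) - F 0) /\<^sub>R h) \<longlongrightarrow> T b x - T 0 x) (at_right 0)"
    by (intro tendsto_diff lim) (use b in auto)
  moreover have "\<forall>\<^sub>F h in at_right 0. (F (b + h) - F b) /\<^sub>R h - (F (0 + h) - F 0) /\<^sub>R h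
      = (T h (F b) - F b) /\<^sub>R h"
    using eventually_at_right_less[of "0::real"]
    by eventually_elim (simp add: shift algebra_simps, simp add: F_def)
  ultimately show ?thesis
    unfolding generator_graph_def F_def[symmetric] by (simp add: tendsto_cong)
qed

text \<open>The means of the orbit over short intervals \<open>{0..b}\<close> lie in the domain and
  tend to \<open>x\<close>.\<close>

lemma generator_dense:
  assumes "e > 0"
  shows "\<exists>z y. (z, y) \<in> generator_graph T \<and> norm (z - x) < e"
proof -
  have "continuous (at 0 within {0..}) (\<lambda>t. T t x)"
    using orbit_continuous by (auto simp: continuous_on_eq_continuous_within)
  then obtain d where d: "d > 0" "\<And>s. 0 \<le> s \<Longrightarrow> s < d \<Longrightarrow> dist (T s x) x < e / 2"
    unfolding continuous_within_eps_delta using assms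
    by (metis abs_of_nonneg atLeast_iff diff_zero dist_real_def half_gt_zero zero_apply)
  define b where "b = d / 2"
  have b: "0 < b" "b < d" using d by (auto simp: b_def)
  have int: "(\<lambda>s. T s x) integrable_on {0..b}"
    by (intro integrable_continuous_real continuous_on_subset[OF orbit_continuous]) auto
  have "norm (integral {0..b} (\<lambda>s. T s x - x)) \<le> e / 2 * (b - 0)"
    using b d(2) by (intro integral_bound continuous_on_diff continuous_on_subset[OF orbit_continuous])
      (auto simp: dist_norm less_imp_le)
  moreover have "integral {0..b} (\<lambda>s. T s x - x) = integral {0..b} (\<lambda>s. T s x) - b *\<^sub>R x"
    using b int by (subst Henstock_Kurzweil_Integration.integral_diff) auto
  moreover have "integral {0..b} (\<lambda>s. T s x) - b *\<^sub>R x
      = b *\<^sub>R (integral {0..b} (\<lambda>s. T s x) /\<^sub>R b - x)"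
    using b by (simp add: algebra_simps)
  ultimately have "norm (integral {0..b} (\<lambda>s. T s x) /\<^sub>R b - x) \<le> e / 2"
    using b by (simp add: mult.commute)
  moreover have "(integral {0..b} (\<lambda>s. T s x) /\<^sub>R b, (T b x - x) /\<^sub>R b) \<in> generator_graph T"
    using b by (intro generator_scaleR integral_in_generator) simp
  ultimately show ?thesis using assms by (intro exI conjI) auto
qed

section \<open>Rescaling and the resolvent of a generator\<close>

text \<open>For \<open>c = - l\<close> with \<open>w < l\<close> the new semigroup decays
  exponentially and its generator is shifted by \<open>- l\<close>, which turns questions about the
  resolvent at \<open>l\<close> into questions about decay.\<close>

lemma rescaled: "exp_bounded_semigroup (\<lambda>t. exp (c * t) *\<^sub>R T t) M (w + c)"
proof
  show "C0_semigroup (\<lambda>t. exp (c * t) *\<^sub>R T t)"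
    unfolding C0_semigroup_def
  proof (intro conjI allI impI)
    show "exp (c * 0) *\<^sub>R T 0 = id_blinfun" by (rule blinfun_eqI) simp
    show "exp (c * (t + s)) *\<^sub>R T (t + s) = (exp (c * t) *\<^sub>R T t) o\<^sub>L (exp (c * s) *\<^sub>R T s)"
      if "0 \<le> t" "0 \<le> s" for t s
      using that by (intro blinfun_eqI)
        (simp add: scaleR_blinfun.rep_eq add_apply blinfun.scaleR_right distrib_left exp_add)
    show "continuous_on {0..} (\<lambda>t. (exp (c * t) *\<^sub>R T t) x)" for x
      by (simp add: scaleR_blinfun.rep_eq) (intro continuous_intros orbit_continuous)
  qed
  show "norm (exp (c * t) *\<^sub>R T t) \<le> M * exp ((w + c) * t)" if "0 \<le> t" for t
    using mult_left_mono[OF bound[OF that], of "exp (c * t)"]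
    by (simp only: distrib_right exp_add norm_scaleR) (simp add: mult_ac)
qed

lemma generator_rescaled:
  assumes "(x, y) \<in> generator_graph T"
  shows "(x, y + c *\<^sub>R x) \<in> generator_graph (\<lambda>t. exp (c * t) *\<^sub>R T t)"
proof -
  have "((\<lambda>h. exp (c * h)) has_vector_derivative c) (at 0 within {0..0 + 1})"
    by (auto simp: has_real_derivative_iff_has_vector_derivative[symmetric] intro!: derivative_eq_intros)
  from right_difference_quotient_tendsto[OF this]
  have 1: "((\<lambda>h. (exp (c * h) - 1) / h) \<longlongrightarrow> c) (at_right 0)"
    by (simp add: divide_inverse mult.commute)
  have 2: "((\<lambda>h. (T h x - x) /\<^sub>R h) \<longlongrightarrow> y) (at_right 0)"
    using assms by (simp add: generator_graph_def)
  have "((\<lambda>h. exp (c * h) *\<^sub>R ((T h x - x) /\<^sub>R h) + ((exp (c * h) - 1) / h) *\<^sub>R x)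
      \<longlongrightarrow> exp (c * 0) *\<^sub>R y + c *\<^sub>R x) (at_right 0)"
    by (intro tendsto_intros 1 2)
  then show ?thesis
    by (simp add: generator_graph_def scaleR_blinfun.rep_eq algebra_simps divide_inverse)
qed

lemma resolvent_surj:
  assumes l: "w < l"
  shows "\<exists>x. (x, l *\<^sub>R x - z) \<in> generator_graph T"
proof -
  interpret S: exp_bounded_semigroup "\<lambda>t. exp (- l * t) *\<^sub>R T t" M "w + (- l)"
    by (rule rescaled)
  let ?S = "\<lambda>t. exp (- l * t) *\<^sub>R T t"
  obtain t where t: "M * exp ((w + (- l)) * t) < 1 / 2" "0 \<le> t"
    using exp_decay_below[of "w + (- l)" "1 / 2" M] l by auto
  \<comment> \<open>\<open>I - S t\<close> is invertible because \<open>S t\<close> is a strict contraction, and \<open>\<integral>\<^sub>0\<^sup>t S s z' ds\<close>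
    is mapped to \<open>z' - S t z'\<close> by \<open>l - A\<close>.\<close>
  have "\<exists>!z'. z + ?S t z' = z'"
  proof (rule banach_fix_type[of "1/2"])
    show "\<forall>a b. dist (z + ?S t a) (z + ?S t b) \<le> 1 / 2 * dist a b"
    proof (intro allI)
      fix a b
      have "dist (z + ?S t a) (z + ?S t b) = norm (?S t (a - b))"
        by (simp only: dist_norm blinfun.diff_right) simp
      also have "\<dots> \<le> 1 / 2 * norm (a - b)"
        by (rule order_trans[OF S.bound_apply[OF t(2)] mult_right_mono]) (use t(1) in auto)
      finally show "dist (z + ?S t a) (z + ?S t b) \<le> 1 / 2 * dist a b" by (simp add: dist_norm)
    qed
  qed auto
  then obtain z' where z': "z + ?S t z' = z'" by blast
  define x where "x = integral {0..t} (\<lambda>s. ?S s z')"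
  have "(x, ?S t z' - z') \<in> generator_graph ?S"
    unfolding x_def by (rule S.integral_in_generator[OF t(2)])
  moreover have "?S t z' - z' = - z"
    using eq_diff_eq[THEN iffD2, OF z'[unfolded add.commute[of z]]] by simp
  ultimately have "(x, - z + l *\<^sub>R x) \<in> generator_graph (\<lambda>t. exp (l * t) *\<^sub>R ?S t)"
    by (intro S.generator_rescaled) simp
  moreover have "(\<lambda>t. exp (l * t) *\<^sub>R ?S t) = T"
    by (simp add: fun_eq_iff exp_minus)
  ultimately show ?thesis by (auto intro!: exI[of _ x])
qed

text \<open>Under the rescaled semigroup \<open>x\<close> has velocity zero and is therefore a fixed
  vector; exponential decay leaves only the fixed vector 0.\<close>

lemma resolvent_inj:
  assumes l: "w < l" and x: "(x, l *\<^sub>R x) \<in> generator_graph T"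
  shows "x = 0"
proof (rule ccontr)
  assume "x \<noteq> 0"
  interpret S: exp_bounded_semigroup "\<lambda>t. exp (- l * t) *\<^sub>R T t" M "w + (- l)"
    by (rule rescaled)
  let ?S = "\<lambda>t. exp (- l * t) *\<^sub>R T t"
  have "(x, 0) \<in> generator_graph ?S"
    using generator_rescaled[OF x, of "- l"] by simp
  then have eq: "?S t x = x" if "0 \<le> t" for t
    using S.orbit_increment_le[of x 0 0 t 0 0] that by simp
  obtain t where t: "M * exp ((w + (- l)) * t) < 1" "0 \<le> t"
    using exp_decay_below[of "w + (- l)" 1 M] l by auto
  have "norm x \<le> M * exp ((w + (- l)) * t) * norm x"
    using S.bound_apply[OF t(2), of x] eq[OF t(2)] by simp
  moreover have "M * exp ((w + (- l)) * t) * norm x < 1 * norm x"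
    using t(1) \<open>x \<noteq> 0\<close> by (intro mult_strict_right_mono) auto
  ultimately show False by simp
qed

text \<open>\<open>resolvent\<close> is defined through \<open>the_inv_into\<close>, so its
  equations become available only once \<open>l - A\<close> is known to map \<open>D\<close>
  bijectively onto the space.\<close>

lemma resolvent_generator:
  assumes gen: "generates D A T" and lin: "linear_operator D A" and l: "w < l"
  shows "resolvent l D A z \<in> D" and "A (resolvent l D A z) = l *\<^sub>R resolvent l D A z - z"
    and "x \<in> D \<Longrightarrow> resolvent l D A (l *\<^sub>R x - A x) = x"
proof -
  have gr: "(x, y) \<in> generator_graph T \<longleftrightarrow> x \<in> D \<and> y = A x" for x y
    using gen by (auto simp: generates_def op_graph_def)
  let ?f = "\<lambda>y. l *\<^sub>R y - A y"
  have inj: "inj_on ?f D"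
  proof (rule inj_onI)
    fix x y assume xy: "x \<in> D" "y \<in> D" "?f x = ?f y"
    have D: "x - y \<in> D" and minus: "(-1) *\<^sub>R y \<in> D"
      using lin xy by (auto simp: linear_operator_def subspace_diff subspace_scale subspace_neg)
    have "A (x + (-1) *\<^sub>R y) = A x + (-1) *\<^sub>R A y"
      using lin xy minus by (metis linear_operator_def)
    then have "A (x - y) = A x - A y" by simp
    also have "\<dots> = l *\<^sub>R (x - y)"
      using xy(3) by (simp add: algebra_simps)
    finally have "A (x - y) = l *\<^sub>R (x - y)" .
    then have "(x - y, l *\<^sub>R (x - y)) \<in> generator_graph T" using D gr by simp
    from resolvent_inj[OF l this] show "x = y" by simp
  qed
  have surj: "z \<in> ?f ` D" for z
  proof -
    obtain x where "(x, l *\<^sub>R x - z) \<in> generator_graph T" using resolvent_surj[OF l] by blast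
    then have "x \<in> D" "l *\<^sub>R x - z = A x" using gr by auto
    then show ?thesis by (intro image_eqI[of _ _ x]) (auto simp: algebra_simps)
  qed
  show "resolvent l D A z \<in> D"
    unfolding resolvent_def by (rule the_inv_into_into[OF inj surj]) simp
  have "?f (resolvent l D A z) = z"
    unfolding resolvent_def by (rule f_the_inv_into_f[OF inj surj])
  then show "A (resolvent l D A z) = l *\<^sub>R resolvent l D A z - z"
    by (simp add: algebra_simps)
  show "x \<in> D \<Longrightarrow> resolvent l D A (l *\<^sub>R x - A x) = x"
    unfolding resolvent_def by (rule the_inv_into_f_f[OF inj])
qed

end

section \<open>Uniform smallness on the line\<close>

text \<open>Compactness of the line with infinity added: finitely many of the local radii cover a
  bounded interval, and \<open>infinity\<close> handles the rest.\<close>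

lemma uniformly_small_near_zero:
  fixes \<Phi> :: "real \<Rightarrow> real \<Rightarrow> 'a::real_normed_vector"
  assumes local: "\<And>s. \<exists>d>0. \<forall>h r. 0 \<le> h \<longrightarrow> h < d \<longrightarrow> \<bar>r - s\<bar> < d \<longrightarrow> norm (\<Phi> h r) \<le> e"
    and infinity: "\<exists>d>0. \<exists>R. \<forall>h r. 0 \<le> h \<longrightarrow> h < d \<longrightarrow> R \<le> \<bar>r\<bar> \<longrightarrow> norm (\<Phi> h r) \<le> e"
  shows "\<exists>d>0. \<forall>h\<in>{0..d}. \<forall>r. norm (\<Phi> h r) \<le> e"
proof -
  obtain d0 R where d0: "d0 > 0"
    "\<And>h r. 0 \<le> h \<Longrightarrow> h < d0 \<Longrightarrow> R \<le> \<bar>r\<bar> \<Longrightarrow> norm (\<Phi> h r) \<le> e"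
    using infinity by blast
  obtain d where d: "\<And>s. d s > 0"
    "\<And>s h r. 0 \<le> h \<Longrightarrow> h < d s \<Longrightarrow> \<bar>r - s\<bar> < d s \<Longrightarrow> norm (\<Phi> h r) \<le> e"
    using local by metis
  have "{-\<bar>R\<bar>..\<bar>R\<bar>} \<subseteq> (\<Union>s\<in>{-\<bar>R\<bar>..\<bar>R\<bar>}. ball s (d s))"
    using d(1) by force
  then obtain S where S: "S \<subseteq> {-\<bar>R\<bar>..\<bar>R\<bar>}" "finite S" "{-\<bar>R\<bar>..\<bar>R\<bar>} \<subseteq> (\<Union>s\<in>S. ball s (d s))"
    by (rule compactE_image[OF compact_Icc, rotated]) auto
  define m where "m = Min (insert d0 (d ` S))"
  have m: "m > 0" "m \<le> d0" "\<And>s. s \<in> S \<Longrightarrow> m \<le> d s"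
    using S(2) d0(1) d(1) by (auto simp: m_def)
  \<comment> \<open>The hypotheses want \<open>h\<close> strictly below the radius; halving
    \<open>m\<close> passes to the closed interval of the conclusion.\<close>
  have "norm (\<Phi> h r) \<le> e" if h: "h \<in> {0..m/2}" for h r
  proof (cases "R \<le> \<bar>r\<bar>")
    case True
    then show ?thesis using d0(2)[of h r] h m by auto
  next
    case False
    then have "r \<in> {-\<bar>R\<bar>..\<bar>R\<bar>}" by auto
    then obtain s where "s \<in> S" "\<bar>r - s\<bar> < d s"
      using S(3) by (auto simp: dist_real_def abs_minus_commute)
    then show ?thesis using d(2)[of h s r] h m(1) m(3)[of s] by auto
  qed
  then show ?thesis using m(1) by (intro exI[of _ "m/2"]) auto
qed

lemma c0_continuous_at:
  fixes f :: "'a::real_normed_vector c0"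
  assumes "e > 0"
  shows "\<exists>d>0. \<forall>r. \<bar>r - s\<bar> < d \<longrightarrow> norm (f r - f s) < e"
proof -
  have "continuous_on UNIV (apply_c0 f)"
    using apply_c0[of f] by (simp add: C0_def)
  then have "isCont (apply_c0 f) s" by (simp add: continuous_on_eq_continuous_at)
  then show ?thesis
    using assms unfolding continuous_at_eps_delta by (auto simp: dist_norm)
qed

lemma c0_small_at_infinity:
  fixes f :: "'a::real_normed_vector c0"
  assumes "e > 0"
  shows "\<exists>R. \<forall>r. R \<le> \<bar>r\<bar> \<longrightarrow> norm (f r) < e"
proof -
  have "(f \<longlongrightarrow> 0) at_infinity"
    using apply_c0[of f] by (simp add: C0_def)
  from tendstoD[OF this assms] show ?thesis by (auto simp: eventually_at_infinity)
qed

lemma c0_translation_continuous: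
  fixes f :: "'a::real_normed_vector c0"
  assumes "e > 0"
  shows "\<exists>d>0. \<forall>h\<in>{0..d}. \<forall>r. norm (f (r + h) - f r) \<le> e"
proof (rule uniformly_small_near_zero)
  fix s
  obtain d where d: "d > 0" "\<And>r. \<bar>r - s\<bar> < d \<Longrightarrow> norm (f r - f s) < e / 2"
    using c0_continuous_at[of "e/2" s f] assms by auto
  have "norm (f (r + h) - f r) \<le> e" if "0 \<le> h" "h < d / 2" "\<bar>r - s\<bar> < d / 2" for h r
  proof -
    have "norm ((f (r + h) - f s) - (f r - f s)) \<le> e"
    proof (intro norm_triangle_le_diff)
      have "\<bar>r + h - s\<bar> < d" "\<bar>r - s\<bar> < d" using that by linarith+
      from d(2)[OF this(1)] d(2)[OF this(2)]
      show "norm (f (r + h) - f s) + norm (f r - f s) \<le> e" by linarith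
    qed
    then show ?thesis by simp
  qed
  then show "\<exists>d>0. \<forall>h r. 0 \<le> h \<longrightarrow> h < d \<longrightarrow> \<bar>r - s\<bar> < d \<longrightarrow> norm (f (r + h) - f r) \<le> e"
    using d(1) by (intro exI[of _ "d/2"]) auto
next
  obtain R where R: "\<And>r. R \<le> \<bar>r\<bar> \<Longrightarrow> norm (f r) < e / 2"
    using c0_small_at_infinity[of "e/2" f] assms by auto
  \<comment> \<open>With \<open>R + 1\<close> in place of \<open>R\<close>, a shift by less than 1
    keeps \<open>r + h\<close> in the region where \<open>f\<close> is small.\<close>
  have "norm (f (r + h) - f r) \<le> e" if "0 \<le> h" "h < 1" "R + 1 \<le> \<bar>r\<bar>" for h r
  proof (intro norm_triangle_le_diff)
    have "R \<le> \<bar>r\<bar>" "R \<le> \<bar>r + h\<bar>" using that by linarith+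
    from R[OF this(1)] R[OF this(2)] show "norm (f (r + h)) + norm (f r) \<le> e" by linarith
  qed
  then show "\<exists>d>0. \<exists>R. \<forall>h r. 0 \<le> h \<longrightarrow> h < d \<longrightarrow> R \<le> \<bar>r\<bar> \<longrightarrow> norm (f (r + h) - f r) \<le> e"
    by (intro exI[of _ 1] conjI exI[of _ "R + 1"]) auto
qed

section \<open>Operator families tending strongly to the identity\<close>

text \<open>Near \<open>s\<close> the moving vector \<open>f r\<close> is replaced by the fixed
  vector \<open>f s\<close>, at a cost of \<open>(K + 1) * norm (f r - f s)\<close>; for large
  \<open>\<bar>r\<bar>\<close> the vector \<open>f r\<close> is itself small. This serves both the
  semigroups generated at each \<open>r\<close> and the propagators from \<open>r\<close> to
  \<open>r + h\<close>.\<close>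

lemma operator_family_uniformly_near_identity:
  fixes L :: "real \<Rightarrow> real \<Rightarrow> 'a::real_normed_vector \<Rightarrow>\<^sub>L 'a" and f :: "'a c0"
  assumes bound: "\<And>h r. 0 \<le> h \<Longrightarrow> h \<le> 1 \<Longrightarrow> norm (L h r) \<le> K"
    and local: "\<And>s x e. e > 0 \<Longrightarrow>
      \<exists>d>0. \<forall>h r. 0 \<le> h \<longrightarrow> h < d \<longrightarrow> \<bar>r - s\<bar> < d \<longrightarrow> norm (L h r x - x) \<le> e"
    and e: "e > 0"
  shows "\<exists>d>0. \<forall>h\<in>{0..d}. \<forall>r. norm (L h r (f r) - f r) \<le> e"
proof -
  have K: "K \<ge> 0" using bound[of 0 0] norm_ge_zero[of "L 0 0"] by linarith
  have Kb: "norm (L h r x - x) \<le> (K + 1) * norm x" if "0 \<le> h" "h \<le> 1" for h r x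
  proof -
    have "norm (L h r x) \<le> K * norm x"
      by (rule order_trans[OF norm_blinfun mult_right_mono[OF bound]]) (use that in auto)
    then show ?thesis using norm_triangle_ineq4[of "L h r x" x] by (simp add: algebra_simps)
  qed
  define e' where "e' = e / (2 * (K + 1))"
  have e': "e' > 0" "(K + 1) * e' = e / 2" using K e by (auto simp: e'_def field_simps)
  show ?thesis
  proof (rule uniformly_small_near_zero)
    fix s
    obtain d1 where d1: "d1 > 0" "\<And>r. \<bar>r - s\<bar> < d1 \<Longrightarrow> norm (f r - f s) < e'"
      using c0_continuous_at[of e' s f] e' by auto
    obtain d2 where d2: "d2 > 0"
      "\<And>h r. 0 \<le> h \<Longrightarrow> h < d2 \<Longrightarrow> \<bar>r - s\<bar> < d2 \<Longrightarrow> norm (L h r (f s) - f s) \<le> e / 2"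
      using local[of "e/2" s "f s"] e by auto
    have "norm (L h r (f r) - f r) \<le> e"
      if "0 \<le> h" "h < Min {1, d1, d2}" "\<bar>r - s\<bar> < Min {1, d1, d2}" for h r
    proof -
      have "norm (L h r (f r - f s) - (f r - f s)) \<le> (K + 1) * e'"
        using that d1(2)[of r] K
        by (intro order_trans[OF Kb mult_left_mono]) auto
      moreover have "norm (L h r (f s) - f s) \<le> e / 2" using d2(2)[of h r] that by auto
      moreover have "L h r (f r) - f r = (L h r (f r - f s) - (f r - f s)) + (L h r (f s) - f s)"
        by (simp add: blinfun.diff_right)
      ultimately show ?thesis using e'(2) by (simp only:) (intro norm_triangle_le, linarith)
    qed
    then show "\<exists>d>0. \<forall>h r. 0 \<le> h \<longrightarrow> h < d \<longrightarrow> \<bar>r - s\<bar> < d \<longrightarrow> norm (L h r (f r) - f r) \<le> e"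
      using d1(1) d2(1) by (intro exI[of _ "Min {1, d1, d2}"]) auto
  next
    obtain R where R: "\<And>r. R \<le> \<bar>r\<bar> \<Longrightarrow> norm (f r) < e'"
      using c0_small_at_infinity[of e' f] e' by auto
    have "norm (L h r (f r) - f r) \<le> e" if "0 \<le> h" "h < 1" "R \<le> \<bar>r\<bar>" for h r
    proof -
      have "norm (L h r (f r) - f r) \<le> (K + 1) * e'"
        using that R[of r] K by (intro order_trans[OF Kb mult_left_mono]) auto
      then show ?thesis using e'(2) e by linarith
    qed
    then show "\<exists>d>0. \<exists>R. \<forall>h r. 0 \<le> h \<longrightarrow> h < d \<longrightarrow> R \<le> \<bar>r\<bar> \<longrightarrow> norm (L h r (f r) - f r) \<le> e"
      by (intro exI[of _ 1] conjI exI[of _ R]) auto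
  qed
qed

text \<open>Resolvent continuity replaces the Trotter-Kato theorem here: an element \<open>z\<close> of the domain at
  \<open>s\<close> is moved to nearby parameters \<open>r\<close> as \<open>R(l, A(r)) (l - A(s)) z\<close>, on which \<open>A(r)\<close> stays bounded.\<close>

lemma semigroup_family_uniformly_near_identity:
  fixes S :: "real \<Rightarrow> real \<Rightarrow> 'a::banach \<Rightarrow>\<^sub>L 'a" and f :: "'a c0"
  assumes lin: "\<And>r. linear_operator (D r) (A r)"
    and gen: "\<And>r. generates (D r) (A r) (S r)"
    and bound: "\<And>r t. 0 \<le> t \<Longrightarrow> norm (S r t) \<le> M * exp (w * t)"
    and cont: "\<And>x. continuous_on UNIV (\<lambda>t. resolvent l (D t) (A t) x)" and l: "w < l"
    and e: "e > 0"
  shows "\<exists>d>0. \<forall>h\<in>{0..d}. \<forall>r. norm (S r h (f r) - f r) \<le> e"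
proof -
  have sg: "exp_bounded_semigroup (S r) M w" for r
    using gen bound by unfold_locales (auto simp: generates_def)
  define K where "K = M * exp (\<bar>w\<bar> * 1) + 1"
  have M: "0 \<le> M" using exp_bounded_semigroup.M_nonneg[OF sg] .
  then have K: "K \<ge> 1" by (simp add: K_def)
  have Kb: "norm (S r h x) \<le> K * norm x" if "0 \<le> h" "h \<le> 1" for r h x
    by (rule order_trans[OF exp_bounded_semigroup.local_bound[OF sg that] mult_right_mono])
      (simp_all add: K_def)
  show ?thesis
  proof (rule operator_family_uniformly_near_identity[where L = "\<lambda>h r. S r h", OF _ _ e])
    show "norm (S r h) \<le> K" if "0 \<le> h" "h \<le> 1" for h r
      using Kb[OF that] K by (intro norm_blinfun_bound) auto
  next
    fix s x and e :: real assume e: "e > 0"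
    \<comment> \<open>By way of \<open>z\<close>, the vector \<open>q r\<close> below is within
      \<open>2 * e'\<close> of \<open>x\<close>, which costs \<open>(K + 1) * (2 * e')\<close>, two
      thirds of \<open>e\<close>. The drift of \<open>q r\<close> during time \<open>h\<close> gets
      the last third.\<close>
    define e' where "e' = e / (3 * (K + 1))"
    have e': "e' > 0" "(K + 1) * e' = e / 3" using K e by (auto simp: e'_def field_simps)
    obtain z y where zy: "(z, y) \<in> generator_graph (S s)" and z: "norm (z - x) < e'"
      using exp_bounded_semigroup.generator_dense[OF sg e'(1)] by blast
    then have zD: "z \<in> D s" using gen[of s] by (auto simp: generates_def op_graph_def)
    define v where "v = l *\<^sub>R z - A s z"
    define q where "q r = resolvent l (D r) (A r) v" for r
    have qs: "q s = z"
      unfolding q_def v_def by (rule exp_bounded_semigroup.resolvent_generator(3)[OF sg gen lin l zD])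
    have q_gen: "(q r, l *\<^sub>R q r - v) \<in> generator_graph (S r)" for r
      using exp_bounded_semigroup.resolvent_generator(1,2)[OF sg gen lin l, of r v] gen[of r]
      by (auto simp: generates_def op_graph_def q_def)
    have "isCont q s"
      unfolding q_def[abs_def] using cont by (simp add: continuous_on_eq_continuous_at)
    then obtain d1 where d1: "d1 > 0" "\<And>r. \<bar>r - s\<bar> < d1 \<Longrightarrow> norm (q r - z) < e'"
      unfolding continuous_at_eps_delta using e' qs by (auto simp: dist_norm)
    \<comment> \<open>The initial velocity of the orbit of \<open>q r\<close> is
      \<open>l *\<^sub>R q r - v\<close>, and \<open>C\<close> bounds its velocity up to time 1,
      uniformly over \<open>r\<close> near \<open>s\<close>.\<close>
    define C where "C = K * (\<bar>l\<bar> * (norm z + e') + norm v) + 1"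
    have C: "C > 0" using K e' by (simp add: C_def add_nonneg_pos)
    have step: "norm (S r h (q r) - q r) \<le> C * h" if "0 \<le> h" "h \<le> 1" "\<bar>r - s\<bar> < d1" for h r
    proof -
      have "norm (q r) \<le> norm z + e'"
        using d1(2)[OF that(3)] norm_triangle_ineq2[of "q r" z] by simp
      then have "\<bar>l\<bar> * norm (q r) \<le> \<bar>l\<bar> * (norm z + e')" by (intro mult_left_mono) auto
      then have "norm (l *\<^sub>R q r - v) \<le> \<bar>l\<bar> * (norm z + e') + norm v"
        by (intro norm_triangle_le_diff) simp
      then have "norm (S r t (l *\<^sub>R q r - v) - 0) \<le> C" if "0 \<le> t" "t \<le> h" for t
      proof -
        have "norm (S r t (l *\<^sub>R q r - v)) \<le> K * norm (l *\<^sub>R q r - v)"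
          by (rule Kb) (use that \<open>h \<le> 1\<close> in auto)
        also have "\<dots> \<le> K * (\<bar>l\<bar> * (norm z + e') + norm v)"
          using K \<open>norm (l *\<^sub>R q r - v) \<le> _\<close> by (intro mult_left_mono) auto
        finally show ?thesis by (simp add: C_def)
      qed
      then have "norm (S r h (q r) - S r 0 (q r) - (h - 0) *\<^sub>R 0) \<le> C * (h - 0)"
        using that by (intro exp_bounded_semigroup.orbit_increment_le[OF sg q_gen]) auto
      then show ?thesis by (simp add: exp_bounded_semigroup.zero_apply[OF sg])
    qed
    have "norm (S r h x - x) \<le> e"
      if h: "0 \<le> h" "h < Min {1, d1, e / (3 * C)}" and r: "\<bar>r - s\<bar> < Min {1, d1, e / (3 * C)}" for h r
    proof -
      have qx: "norm (x - q r) \<le> 2 * e'"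
        using d1(2)[of r] r z norm_triangle_ineq[of "x - z" "z - q r"]
        by (auto simp: norm_minus_commute)
      have "S r h x - x = S r h (x - q r) - (x - q r) + (S r h (q r) - q r)"
        by (simp add: blinfun.diff_right)
      moreover have "norm (S r h (x - q r) - (x - q r)) \<le> K * (2 * e') + 2 * e'"
      proof (rule norm_triangle_le_diff[OF add_mono[OF _ qx]])
        show "norm (S r h (x - q r)) \<le> K * (2 * e')"
          using h qx K by (intro order_trans[OF Kb] mult_left_mono[OF qx]) auto
      qed
      moreover have "K * (2 * e') + 2 * e' = 2 * e / 3"
        using e'(2) by (simp add: algebra_simps)
      moreover have "norm (S r h (q r) - q r) \<le> C * h" using step h r by auto
      moreover have "C * h \<le> e / 3" using h C by (auto simp: field_simps)
      ultimately show ?thesis by (simp only:) (intro norm_triangle_le, linarith)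
    qed
    then show "\<exists>d>0. \<forall>h r. 0 \<le> h \<longrightarrow> h < d \<longrightarrow> \<bar>r - s\<bar> < d \<longrightarrow> norm (S r h x - x) \<le> e"
      using d1(1) e C by (intro exI[of _ "Min {1, d1, e / (3 * C)}"]) auto
  qed
qed

section \<open>Evolution semigroups\<close>

text \<open>The increment \<open>T b x - T a x\<close> equals \<open>T a (T (b - a) x - x)\<close>,
  so the bound on \<open>T a\<close> carries right continuity at 0 to both sides of any
  time.\<close>

lemma C0_semigroupI_right_continuous:
  fixes T :: "real \<Rightarrow> 'a::real_normed_vector \<Rightarrow>\<^sub>L 'a"
  assumes zero: "T 0 = id_blinfun"
    and add: "\<And>s t. 0 \<le> s \<Longrightarrow> 0 \<le> t \<Longrightarrow> T (s + t) = T s o\<^sub>L T t"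
    and bound: "\<And>t. 0 \<le> t \<Longrightarrow> norm (T t) \<le> M * exp (w * t)"
    and right: "\<And>x e. e > 0 \<Longrightarrow> \<exists>d>0. \<forall>h\<in>{0..d}. norm (T h x - x) \<le> e"
  shows "C0_semigroup T"
  unfolding C0_semigroup_def
proof (intro conjI allI impI zero add)
  fix x
  have M: "0 \<le> M" using bound[of 0] norm_ge_zero[of "T 0"] by (simp del: norm_ge_zero)
  show "continuous_on {0..} (\<lambda>t. T t x)"
    unfolding continuous_on_iff
  proof (intro ballI allI impI)
    fix t e :: real assume t: "t \<in> {0..}" and e: "e > 0"
    define K where "K = M * exp (\<bar>w\<bar> * (t + 1)) + 1"
    have K: "K > 0" using M by (simp add: K_def add_nonneg_pos)
    obtain d where d: "d > 0" "\<And>h. 0 \<le> h \<Longrightarrow> h \<le> d \<Longrightarrow> norm (T h x - x) \<le> e / (2 * K)"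
      using right[of "e / (2 * K)" x] e K by auto
    have main: "norm (T b x - T a x) < e" if "0 \<le> a" "a \<le> b" "a \<le> t + 1" "b - a \<le> d" for a b
    proof -
      have "w * a \<le> \<bar>w\<bar> * (t + 1)" using that by (intro mult_mono) auto
      then have "M * exp (w * a) \<le> M * exp (\<bar>w\<bar> * (t + 1))"
        using M by (intro mult_left_mono) auto
      then have "M * exp (w * a) \<le> K" by (simp add: K_def)
      then have "norm (T a) \<le> K" using bound[OF that(1)] by linarith
      moreover have "T b x - T a x = T a (T (b - a) x - x)"
        using add[of a "b - a"] that by (simp add: blinfun.diff_right)
      ultimately have "norm (T b x - T a x) \<le> K * (e / (2 * K))"
        using that K d(2)[of "b - a"] order_trans[OF norm_blinfun mult_mono[of "norm (T a)" K]]
        by (simp del: times_divide_eq_right)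
      also have "\<dots> < e" using K e by simp
      finally show ?thesis .
    qed
    show "\<exists>d>0. \<forall>r\<in>{0..}. dist r t < d \<longrightarrow> dist (T r x) (T t x) < e"
    proof (intro exI[of _ "min d 1"] conjI ballI impI)
      fix r :: real assume r: "r \<in> {0..}" "dist r t < min d 1"
      show "dist (T r x) (T t x) < e"
      proof (cases "t \<le> r")
        case True
        then show ?thesis using main[of t r] r t by (auto simp: dist_norm)
      next
        case False
        then show ?thesis using main[of r t] r t by (auto simp: dist_norm norm_minus_commute)
      qed
    qed (use d in auto)
  qed
qed

text \<open>At \<open>s\<close>, with \<open>r = s - h\<close>, the increment of the semigroup is
  \<open>(U (r + h) r (f r) - f r) - (f (r + h) - f r)\<close>. The first part is uniformly small
  because \<open>U\<close> is strongly continuous at the diagonal, the second because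
  \<open>f\<close> is uniformly continuous.\<close>

lemma evolution_semigroup_exp_bounded:
  fixes U :: "real \<Rightarrow> real \<Rightarrow> 'a::banach \<Rightarrow>\<^sub>L 'a"
  assumes U: "evolution_family U"
  shows "\<exists>M w. exp_bounded_semigroup (evolution_semigroup U) M w"
proof -
  obtain M w where M: "1 \<le> M" and bd: "\<And>t s. s \<le> t \<Longrightarrow> norm (U t s) \<le> M * exp (w * (t - s))"
    using U unfolding evolution_family_def by blast
  have comp: "U t r (U r s x) = U t s x" if "s \<le> r" "r \<le> t" for t r s x
    using U that unfolding evolution_family_def by (metis blinfun_apply_blinfun_compose)
  have id: "U t t = id_blinfun" for t using U unfolding evolution_family_def by blast
  have cont: "continuous_on {(t, s). s \<le> t} (\<lambda>(t, s). U t s x)" for x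
    using U unfolding evolution_family_def by blast
  note app = evolution_semigroup_apply[OF U]
  have bound: "norm (evolution_semigroup U t) \<le> M * exp (w * t)" if t: "0 \<le> t" for t
  proof (rule norm_blinfun_bound)
    show "norm (evolution_semigroup U t f) \<le> M * exp (w * t) * norm f" for f
    proof (rule norm_c0_leI)
      fix s
      have "norm (U s (s - t) (f (s - t))) \<le> norm (U s (s - t)) * norm (f (s - t))"
        by (rule norm_blinfun)
      also have "\<dots> \<le> (M * exp (w * t)) * norm f"
        using bd[of "s - t" s] t M by (intro mult_mono norm_apply_c0_le) auto
      finally show "norm (evolution_semigroup U t f s) \<le> M * exp (w * t) * norm f"
        by (simp add: app[OF t])
    qed
  qed (use M in auto)
  have "C0_semigroup (evolution_semigroup U)"
  proof (rule C0_semigroupI_right_continuous[OF _ _ bound])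
    show "evolution_semigroup U 0 = id_blinfun"
      by (intro blinfun_eqI c0_eqI) (simp add: app id)
    show "evolution_semigroup U (s + t) = evolution_semigroup U s o\<^sub>L evolution_semigroup U t"
      if "0 \<le> s" "0 \<le> t" for s t
      using that by (intro blinfun_eqI c0_eqI) (simp add: app comp diff_diff_eq)
    fix f :: "'a c0" and e :: real assume e: "e > 0"
    \<comment> \<open>With \<open>\<bar>h\<bar>\<close> the two times are correctly ordered for
      every real \<open>h\<close>.\<close>
    have "\<exists>d>0. \<forall>h\<in>{0..d}. \<forall>r. norm (U (r + \<bar>h\<bar>) r (f r) - f r) \<le> e / 2"
    proof (rule operator_family_uniformly_near_identity[where L = "\<lambda>h r. U (r + \<bar>h\<bar>) r"])
      show "norm (U (r + \<bar>h\<bar>) r) \<le> M * exp \<bar>w\<bar>" if "0 \<le> h" "h \<le> 1" for h r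
      proof -
        have "w * h \<le> \<bar>w\<bar> * 1" using that by (intro mult_mono) auto
        then have "M * exp (w * h) \<le> M * exp \<bar>w\<bar>" using M by (intro mult_left_mono) auto
        then show ?thesis using bd[of r "r + \<bar>h\<bar>"] that by simp
      qed
      fix s x and e :: real assume "e > 0"
      then obtain d where d: "d > 0" "\<And>p. p \<in> {(t, s). s \<le> t} \<Longrightarrow> dist p (s, s) < d \<Longrightarrow>
          dist ((\<lambda>(t, s). U t s x) p) ((\<lambda>(t, s). U t s x) (s, s)) < e"
        using cont[of x] unfolding continuous_on_iff
        by (metis (mono_tags, lifting) case_prodI mem_Collect_eq order_refl)
      have "norm (U (r + \<bar>h\<bar>) r x - x) \<le> e" if "0 \<le> h" "h < d / 3" "\<bar>r - s\<bar> < d / 3" for h r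
      proof -
        have "dist (r + \<bar>h\<bar>, r) (s, s) \<le> \<bar>r + h - s\<bar> + \<bar>r - s\<bar>"
          using that sqrt_sum_squares_le_sum_abs[of "r + h - s" "r - s"]
          by (simp add: dist_Pair_Pair dist_real_def)
        also have "\<dots> < d" using that by linarith
        finally show ?thesis using d(2)[of "(r + \<bar>h\<bar>, r)"] by (simp add: id dist_norm)
      qed
      then show "\<exists>d>0. \<forall>h r. 0 \<le> h \<longrightarrow> h < d \<longrightarrow> \<bar>r - s\<bar> < d \<longrightarrow> norm (U (r + \<bar>h\<bar>) r x - x) \<le> e"
        using d(1) by (intro exI[of _ "d/3"]) auto
    qed (use e in auto)
    then obtain d1 where d1: "d1 > 0" "\<And>h r. 0 \<le> h \<Longrightarrow> h \<le> d1 \<Longrightarrow> norm (U (r + h) r (f r) - f r) \<le> e / 2"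
      by auto
    obtain d2 where d2: "d2 > 0" "\<And>h r. 0 \<le> h \<Longrightarrow> h \<le> d2 \<Longrightarrow> norm (f (r + h) - f r) \<le> e / 2"
      using c0_translation_continuous[of "e/2" f] e by auto
    have "norm (evolution_semigroup U h f - f) \<le> e" if "h \<in> {0..min d1 d2}" for h
    proof (rule norm_c0_leI)
      fix s
      have "norm ((U (s - h + h) (s - h) (f (s - h)) - f (s - h)) - (f (s - h + h) - f (s - h))) \<le> e"
        using d1(2)[of h "s - h"] d2(2)[of h "s - h"] that by (intro norm_triangle_le_diff) auto
      then show "norm ((evolution_semigroup U h f - f) s) \<le> e"
        using that by (simp add: app)
    qed
    then show "\<exists>d>0. \<forall>h\<in>{0..d}. norm (evolution_semigroup U h f - f) \<le> e"
      using d1(1) d2(1) by (intro exI[of _ "min d1 d2"]) auto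
  qed
  then show ?thesis
    using bound by (intro exI[of _ M] exI[of _ w]) (rule exp_bounded_semigroup.intro)
qed

section \<open>Approximation of orbits by curves in a core\<close>

lemma norm_convex_combination_le:
  fixes x y z :: "'a::real_normed_vector"
  assumes "0 \<le> q" "q \<le> 1" "norm (x - z) \<le> e" "norm (y - z) \<le> e"
  shows "norm ((1 - q) *\<^sub>R x + q *\<^sub>R y - z) \<le> e"
proof -
  have "(1 - q) *\<^sub>R x + q *\<^sub>R y \<in> cball z e"
    using assms by (intro convexD[OF convex_cball]) (auto simp: dist_norm norm_minus_commute)
  then show ?thesis by (simp add: dist_norm norm_minus_commute)
qed

lemma linear_operator_linear_combination:
  assumes "linear_operator D C" "x \<in> D" "y \<in> D"
  shows "C (a *\<^sub>R x + b *\<^sub>R y) = a *\<^sub>R C x + b *\<^sub>R C y"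
  using assms unfolding linear_operator_def by (simp add: subspace_scale)

context exp_bounded_semigroup
begin

text \<open>The core need not be invariant under \<open>T\<close>, so the orbit itself cannot be used; it is
  replaced by the linear interpolation of core elements close, in the graph norm, to its values
  on a grid of width \<open>\<delta>\<close>.\<close>

lemma core_curve_approximation:
  assumes core: "generator_graph T \<subseteq> closure (op_graph D C)" and lin: "linear_operator D C"
    and fy: "(f, y) \<in> generator_graph T" and e: "e > 0"
  shows "\<exists>v F \<delta>. finite F \<and> F \<subseteq> D \<and> \<delta> > 0 \<and> (\<forall>a\<in>{0..\<tau>}.
    (\<exists>p\<in>F. \<exists>q\<in>F. \<exists>\<theta>\<in>{0..1}. v a = (1 - \<theta>) *\<^sub>R p + \<theta> *\<^sub>R q) \<and>
    norm (v a - T a f) \<le> e \<and>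
    (\<forall>h\<in>{0..\<delta>}. norm (v (a + h) - v a - h *\<^sub>R C (v a)) \<le> e * h))"
proof (cases "0 \<le> \<tau>")
  case False
  then show ?thesis by (intro exI[of _ "\<lambda>_. 0"] exI[of _ "{}"] exI[of _ 1]) auto
next
  case \<tau>: True
  \<comment> \<open>Starting from \<open>a \<le> \<tau>\<close>, a step may use nodes up to
    \<open>\<tau> + 2\<close>, since the grid width will be at most 1; the interval leaves room
    beyond that.\<close>
  have uc: "\<exists>d>0. \<forall>s\<in>{0..\<tau>+3}. \<forall>s'\<in>{0..\<tau>+3}. dist s' s < d \<longrightarrow> dist (T s' z) (T s z) < e / 3" for z
  proof -
    have "uniformly_continuous_on {0..\<tau>+3} (\<lambda>t. T t z)"
      by (intro compact_uniformly_continuous continuous_on_subset[OF orbit_continuous]) auto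
    moreover have "e / 3 > 0" using e by simp
    ultimately show ?thesis unfolding uniformly_continuous_on_def by blast
  qed
  obtain d1 where d1: "d1 > 0" "\<And>s s'. s \<in> {0..\<tau>+3} \<Longrightarrow> s' \<in> {0..\<tau>+3} \<Longrightarrow> dist s' s < d1 \<Longrightarrow> dist (T s' f) (T s f) < e / 3"
    using uc[of f] by blast
  obtain d2 where d2: "d2 > 0" "\<And>s s'. s \<in> {0..\<tau>+3} \<Longrightarrow> s' \<in> {0..\<tau>+3} \<Longrightarrow> dist s' s < d2 \<Longrightarrow> dist (T s' y) (T s y) < e / 3"
    using uc[of y] by blast
  \<comment> \<open>Times compared below are at most two cells apart, hence closer than
    \<open>3 * \<delta>\<close>.\<close>
  define \<delta> where "\<delta> = Min {1, d1 / 3, d2 / 3}"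
  have \<delta>: "\<delta> > 0" "\<delta> \<le> 1" "3 * \<delta> \<le> d1" "3 * \<delta> \<le> d2"
    using d1(1) d2(1) by (auto simp: \<delta>_def min_def)
  \<comment> \<open>Forming slopes divides the errors at two neighbouring nodes by
    \<open>\<delta>\<close>; this choice makes the result
    \<open>2 * \<eta> / \<delta> = e / 3\<close>.\<close>
  define \<eta> where "\<eta> = e * \<delta> / 6"
  have \<eta>: "\<eta> > 0" "\<eta> \<le> e / 3" "2 * \<eta> / \<delta> = e / 3"
    using e \<delta> by (auto simp: \<eta>_def)
  have "\<exists>g\<in>D. norm (g - T (real j * \<delta>) f) < \<eta> \<and> norm (C g - T (real j * \<delta>) y) < \<eta>" for j
  proof -
    have "(T (real j * \<delta>) f, T (real j * \<delta>) y) \<in> closure (op_graph D C)"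
      using core generator_orbit[OF fy, of "real j * \<delta>"] \<delta> by auto
    then obtain p where p: "p \<in> op_graph D C" "dist p (T (real j * \<delta>) f, T (real j * \<delta>) y) < \<eta>"
      using \<eta> unfolding closure_approachable by blast
    then obtain g where g: "g \<in> D" "p = (g, C g)" by (auto simp: op_graph_def)
    have "dist g (T (real j * \<delta>) f) < \<eta>" "dist (C g) (T (real j * \<delta>) y) < \<eta>"
      using p(2) g(2) dist_fst_le[of p "(T (real j * \<delta>) f, T (real j * \<delta>) y)"]
        dist_snd_le[of p "(T (real j * \<delta>) f, T (real j * \<delta>) y)"] by auto
    then show ?thesis using g(1) by (auto simp: dist_norm)
  qed
  then obtain g where gD: "\<And>j. g j \<in> D"
    and g: "\<And>j. norm (g j - T (real j * \<delta>) f) < \<eta>" "\<And>j. norm (C (g j) - T (real j * \<delta>) y) < \<eta>"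
    by metis
  have scaled_norm: "norm (z /\<^sub>R \<delta>) = norm z / \<delta>" for z :: 'a
    using \<delta>(1) by (simp add: divide_inverse_commute)
  define d where "d j = (g (Suc j) - g j) /\<^sub>R \<delta>" for j
  \<comment> \<open>The node \<open>i\<close> may be an end of the cell \<open>j\<close> or the node
    just before it: a step of length at most \<open>\<delta>\<close> can cross into the next cell,
    whose slope is then compared with \<open>C\<close> at both ends of the previous cell.\<close>
  have slope: "norm (C (g i) - d j) \<le> e"
    if j: "real (Suc j) * \<delta> \<le> \<tau> + 3" and i: "i \<le> Suc j" "j \<le> Suc i" for i j
  proof -
    let ?a = "real j * \<delta>" and ?b = "real (Suc j) * \<delta>" and ?c = "real i * \<delta>"
    have ba: "?b - ?a = \<delta>" by (simp add: algebra_simps)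
    have c: "0 \<le> ?c" "?c \<le> ?b" "?a - \<delta> \<le> ?c" "0 \<le> ?a"
    proof -
      have "real i * \<delta> \<le> real (Suc j) * \<delta>" using i \<delta> by (intro mult_right_mono) auto
      then show "?c \<le> ?b" .
      have "real j * \<delta> \<le> real (Suc i) * \<delta>" using i \<delta> by (intro mult_right_mono) auto
      then show "?a - \<delta> \<le> ?c" by (simp add: algebra_simps)
    qed (use \<delta> in auto)
    have "norm (T ?b f - T ?a f - (?b - ?a) *\<^sub>R T ?c y) \<le> e / 3 * (?b - ?a)"
    proof (rule orbit_increment_le[OF fy])
      fix s assume s: "?a \<le> s" "s \<le> ?b"
      have "\<bar>s - ?c\<bar> < d2" using s c ba \<delta> by (simp only: abs_if split: if_split) linarith
      then have "dist s ?c < d2" by (simp only: dist_real_def)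
      then have "dist (T s y) (T ?c y) < e / 3"
        using s c j \<delta> by (intro d2(2)) (unfold atLeastAtMost_iff, (intro conjI; linarith)+)
      then show "norm (T s y - T ?c y) \<le> e / 3" by (simp add: dist_norm)
    qed (use c ba \<delta> in auto)
    moreover have "T ?b f - T ?a f - (?b - ?a) *\<^sub>R T ?c y
        = \<delta> *\<^sub>R ((T ?b f - T ?a f) /\<^sub>R \<delta> - T ?c y)"
      using \<delta> unfolding ba by (simp add: scaleR_right_diff_distrib)
    ultimately have 1: "norm ((T ?b f - T ?a f) /\<^sub>R \<delta> - T ?c y) \<le> e / 3"
      using \<delta> unfolding ba by (simp add: mult.commute)
    have "norm ((g (Suc j) - T ?b f) - (g j - T ?a f)) \<le> 2 * \<eta>"
      using g(1)[of "Suc j"] g(1)[of j] by (intro norm_triangle_le_diff) auto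
    then have "norm (((g (Suc j) - T ?b f) - (g j - T ?a f)) /\<^sub>R \<delta>) \<le> e / 3"
      using divide_right_mono[of _ "2 * \<eta>" \<delta>] \<delta>(1) unfolding scaled_norm \<eta>(3) by auto
    moreover have "((g (Suc j) - T ?b f) - (g j - T ?a f)) /\<^sub>R \<delta>
        = d j - (T ?b f - T ?a f) /\<^sub>R \<delta>"
      by (simp add: d_def scaleR_right_diff_distrib)
    ultimately have 2: "norm (d j - (T ?b f - T ?a f) /\<^sub>R \<delta>) \<le> e / 3" by (simp only:)
    have 3: "norm (C (g i) - T ?c y) \<le> e / 3" using g(2)[of i] \<eta>(2) by simp
    let ?q = "(T ?b f - T ?a f) /\<^sub>R \<delta>"
    have "C (g i) - d j = (C (g i) - T ?c y) - (?q - T ?c y) - (d j - ?q)" by simp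
    also have "norm \<dots> \<le> e / 3 + e / 3 + e / 3"
      by (intro norm_triangle_le_diff add_mono 1 2 3)
    finally show ?thesis by simp
  qed
  define k where "k s = nat \<lfloor>s / \<delta>\<rfloor>" for s
  define v where "v s = g (k s) + (s - real (k s) * \<delta>) *\<^sub>R d (k s)" for s
  have kI: "k s = j" if "real j * \<delta> \<le> s" "s < real (Suc j) * \<delta>" for s j
  proof -
    have "\<lfloor>s / \<delta>\<rfloor> = int j" using that \<delta> by (intro floor_unique) (auto simp: field_simps)
    then show ?thesis by (simp add: k_def)
  qed
  have k: "real (k s) * \<delta> \<le> s" "s < real (Suc (k s)) * \<delta>" if "0 \<le> s" for s
  proof -
    have "0 \<le> s / \<delta>" using that \<delta> by simp
    then have "real (k s) \<le> s / \<delta>" "s / \<delta> < real (k s) + 1"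
      unfolding k_def by linarith+
    then show "real (k s) * \<delta> \<le> s" "s < real (Suc (k s)) * \<delta>"
      using \<delta> by (auto simp: field_simps)
  qed
  \<comment> \<open>Every cell met by \<open>{0..\<tau>}\<close> has its two end nodes in this
    finite set.\<close>
  define F where "F = g ` {..Suc (k \<tau>)}"
  have "(\<exists>p\<in>F. \<exists>q\<in>F. \<exists>\<theta>\<in>{0..1}. v a = (1 - \<theta>) *\<^sub>R p + \<theta> *\<^sub>R q) \<and> norm (v a - T a f) \<le> e \<and>
      (\<forall>h\<in>{0..\<delta>}. norm (v (a + h) - v a - h *\<^sub>R C (v a)) \<le> e * h)"
    if a: "a \<in> {0..\<tau>}" for a
  proof -
    define j where "j = k a"
    define \<theta> where "\<theta> = (a - real j * \<delta>) / \<delta>"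
    have ja: "real j * \<delta> \<le> a" "a < real (Suc j) * \<delta>" using k[of a] a by (auto simp: j_def)
    have \<theta>: "0 \<le> \<theta>" "\<theta> \<le> 1" using ja \<delta> by (auto simp: \<theta>_def field_simps)
    have va: "v a = (1 - \<theta>) *\<^sub>R g j + \<theta> *\<^sub>R g (Suc j)"
      using \<delta> by (simp add: v_def j_def[symmetric] d_def \<theta>_def divide_inverse algebra_simps)
    have "j \<le> k \<tau>" unfolding j_def k_def using a \<delta>
      by (intro nat_mono floor_mono divide_right_mono) auto
    then have F: "g j \<in> F" "g (Suc j) \<in> F" by (auto simp: F_def)
    have jt: "real (Suc j) * \<delta> \<le> \<tau> + 1" "real (Suc (Suc j)) * \<delta> \<le> \<tau> + 2"
      using ja a \<delta> by (auto simp: algebra_simps)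
    have near: "norm (g i - T a f) \<le> e" if i: "i = j \<or> i = Suc j" for i
    proof -
      have "dist (real i * \<delta>) a < d1" using ja i \<delta> by (auto simp: dist_real_def abs_if algebra_simps)
      moreover have "real i * \<delta> \<in> {0..\<tau>+3}"
        using i jt \<delta> ja a by (auto simp: algebra_simps)
      ultimately have "dist (T (real i * \<delta>) f) (T a f) < e / 3" using a by (intro d1(2)) auto
      then have "norm ((g i - T (real i * \<delta>) f) + (T (real i * \<delta>) f - T a f)) \<le> e"
        using g(1)[of i] \<eta>(2) e by (intro norm_triangle_le) (simp add: dist_norm)
      then show ?thesis by simp
    qed
    have "norm (v a - T a f) \<le> e"
      unfolding va using \<theta> near by (intro norm_convex_combination_le) auto
    moreover have "norm (v (a + h) - v a - h *\<^sub>R C (v a)) \<le> e * h" if h: "h \<in> {0..\<delta>}" for h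
    proof -
      have Cv: "C (v a) = (1 - \<theta>) *\<^sub>R C (g j) + \<theta> *\<^sub>R C (g (Suc j))"
        unfolding va by (rule linear_operator_linear_combination[OF lin gD gD])
      have dj: "norm (d i - C (v a)) \<le> e" if "i = j \<or> i = Suc j" for i
        unfolding Cv using \<theta> jt that
        by (subst norm_minus_commute) (intro norm_convex_combination_le slope, auto)
      have vj: "v a = g j + (a - real j * \<delta>) *\<^sub>R d j" by (simp add: v_def j_def)
      show ?thesis
      proof (cases "a + h < real (Suc j) * \<delta>")
        case True
        then have "k (a + h) = j" using ja h by (intro kI) auto
        then have "v (a + h) - v a - h *\<^sub>R C (v a) = h *\<^sub>R (d j - C (v a))"
          unfolding vj[symmetric] by (simp add: v_def[of "a + h"] vj algebra_simps)
        then show ?thesis using dj[of j] h by (simp add: mult.commute[of e] mult_left_mono)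
      next
        case False
        \<comment> \<open>The step crosses the node at \<open>?m\<close>, so its increment is split
          there into pieces with slopes \<open>d j\<close> and \<open>d (Suc j)\<close>.\<close>
        let ?m = "real (Suc j) * \<delta>"
        have "a + h < real (Suc (Suc j)) * \<delta>" using ja h by (auto simp: algebra_simps)
        then have "k (a + h) = Suc j" using False by (intro kI) auto
        moreover have "g (Suc j) = g j + \<delta> *\<^sub>R d j" using \<delta> by (simp add: d_def)
        ultimately have "v (a + h) - v a - h *\<^sub>R C (v a)
            = (?m - a) *\<^sub>R (d j - C (v a)) + (a + h - ?m) *\<^sub>R (d (Suc j) - C (v a))"
          by (simp add: v_def[of "a + h"]) (simp add: vj algebra_simps)
        also have "norm \<dots> \<le> (?m - a) * e + (a + h - ?m) * e"
          using ja False dj by (intro norm_triangle_le add_mono) (auto intro!: mult_left_mono)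
        also have "\<dots> = e * h" by (simp add: algebra_simps)
        finally show ?thesis .
      qed
    qed
    moreover have "\<exists>p\<in>F. \<exists>q\<in>F. \<exists>\<theta>\<in>{0..1}. v a = (1 - \<theta>) *\<^sub>R p + \<theta> *\<^sub>R q"
      using F \<theta> by (intro bexI[of _ "g j"] bexI[of _ "g (Suc j)"] bexI[of _ \<theta>] va) auto
    ultimately show ?thesis by blast
  qed
  then show ?thesis
    using gD \<delta>(1) by (intro exI[of _ v] exI[of _ F] exI[of _ \<delta>]) (auto simp: F_def)
qed

end

section \<open>Chernoff's product formula for evolution families\<close>

text \<open>The global error is a sum of one-step errors, each propagated by a shorter product. The
  vectors \<open>u k\<close> are arbitrary, so an approximate solution may be inserted.\<close>

lemma prod_decreasing_telescope:
  "prod_decreasing V n (u n) - u 0 = (\<Sum>k<n. prod_decreasing V k (V (Suc k) (u (Suc k)) - u k))"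
  by (induction n) (auto simp: blinfun.diff_right algebra_simps)

text \<open>The two kinds of product grow at opposite ends; splitting off the left factor here makes
  them comparable.\<close>

lemma prod_decreasing_Suc_left:
  "prod_decreasing V (Suc n) = V 1 o\<^sub>L prod_decreasing (\<lambda>p. V (Suc p)) n"
  by (induction n) (auto intro!: blinfun_eqI)

lemma prod_decreasing_cong:
  "(\<And>p. 1 \<le> p \<Longrightarrow> p \<le> n \<Longrightarrow> V p = V' p) \<Longrightarrow> prod_decreasing V n = prod_decreasing V' n"
  by (induction n) auto

lemma prod_increasing_eq_decreasing:
  "prod_increasing V n = prod_decreasing (\<lambda>p. V (n - p)) n"
  by (induction n) (simp_all add: prod_decreasing_Suc_left del: prod_decreasing.simps(2))

text \<open>Each of the \<open>n\<close> one-step errors contributes at most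
  \<open>K * (2 * e' * h)\<close>, and \<open>real n * h = t\<close> keeps their sum bounded
  independently of \<open>n\<close>. What remains is the distance from the curve to \<open>f\<close>
  at the start and to the orbit at time \<open>t\<close>.\<close>

lemma chernoff_evolution_family:
  fixes W :: "real \<Rightarrow> real \<Rightarrow> 'a::banach \<Rightarrow>\<^sub>L 'a" and F :: "real \<Rightarrow> real \<Rightarrow> 'a \<Rightarrow>\<^sub>L 'a"
    and f :: "'a c0"
  assumes W: "evolution_family W"
    and core: "generator_graph (evolution_semigroup W) \<subseteq> closure (op_graph D C)"
    and lin: "linear_operator D C"
    and stable: "\<And>h n s. 0 \<le> h \<Longrightarrow>
      norm (prod_decreasing (\<lambda>p. F h (s - real p * h)) n) \<le> M * exp (\<omega> * (real n * h))"
    and consistent: "\<And>g e. g \<in> D \<Longrightarrow> e > 0 \<Longrightarrow>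
      \<exists>d>0. \<forall>h\<in>{0..d}. \<forall>s. norm (F h (s - h) (g (s - h)) - g s - h *\<^sub>R C g s) \<le> e * h"
    and e: "e > 0" and \<tau>: "0 \<le> \<tau>"
  shows "\<exists>N. \<forall>n\<ge>N. \<forall>t\<in>{0..\<tau>}. \<forall>s.
    norm (prod_decreasing (\<lambda>p. F (t / real n) (s - real p * (t / real n))) n (f (s - t))
      - W s (s - t) (f (s - t))) \<le> e"
proof -
  obtain M' w where "exp_bounded_semigroup (evolution_semigroup W) M' w"
    using evolution_semigroup_exp_bounded[OF W] by blast
  then interpret T: exp_bounded_semigroup "evolution_semigroup W" M' w .
  let ?T = "evolution_semigroup W"
  \<comment> \<open>One constant for the products and the semigroup up to time
    \<open>\<tau>\<close>; \<open>max M 0\<close> makes the estimate monotone in the exponential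
    whatever the sign of \<open>M\<close>.\<close>
  define K where "K = max 1 (max M 0 * exp (\<bar>\<omega>\<bar> * \<tau>) + M' * exp (\<bar>w\<bar> * \<tau>))"
  have K: "K \<ge> 1" by (simp add: K_def)
  have stab: "norm (prod_decreasing (\<lambda>p. F h (s - real p * h)) n x) \<le> K * norm x"
    if h: "0 \<le> h" "real n * h \<le> \<tau>" for h s n x
  proof (rule order_trans[OF norm_blinfun mult_right_mono[OF _ norm_ge_zero]])
    have "\<omega> * (real n * h) \<le> \<bar>\<omega>\<bar> * \<tau>" using h by (intro mult_mono) auto
    then have "M * exp (\<omega> * (real n * h)) \<le> max M 0 * exp (\<bar>\<omega>\<bar> * \<tau>)"
      by (intro mult_mono) auto
    also have "\<dots> \<le> K" using T.M_nonneg by (simp add: K_def le_max_iff_disj)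
    finally show "norm (prod_decreasing (\<lambda>p. F h (s - real p * h)) n) \<le> K"
      using stable[OF h(1)] by (rule order_trans[rotated])
  qed
  have Tb: "norm (?T t x) \<le> K * norm x" if "0 \<le> t" "t \<le> \<tau>" for t x
    by (rule order_trans[OF T.local_bound[OF that] mult_right_mono])
      (auto simp: K_def le_max_iff_disj)
  \<comment> \<open>The budget is \<open>2 * K * e' * \<tau>\<close> for the telescoping sum and at
    most \<open>8 * K * e'\<close> for the two ends of the curve.\<close>
  define e' where "e' = e / (2 * K * (\<tau> + 4))"
  have e': "e' > 0" using e K \<tau> by (simp add: e'_def)
  have e'e: "2 * K * e' * \<tau> + 8 * K * e' = e"
  proof -
    have "2 * K * (\<tau> + 4) * e' = e" using K \<tau> by (simp add: e'_def)
    then show ?thesis by (simp add: algebra_simps)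
  qed
  obtain f' y where f'y: "(f', y) \<in> generator_graph ?T" and f': "norm (f' - f) < e'"
    using T.generator_dense[OF e'] by blast
  from T.core_curve_approximation[OF core lin f'y e', of \<tau>]
  obtain v G d where G: "finite G" "G \<subseteq> D" and d: "d > 0" and v': "\<forall>a\<in>{0..\<tau>}.
      (\<exists>p\<in>G. \<exists>q\<in>G. \<exists>\<theta>\<in>{0..1}. v a = (1 - \<theta>) *\<^sub>R p + \<theta> *\<^sub>R q) \<and>
      norm (v a - ?T a f') \<le> e' \<and>
      (\<forall>h\<in>{0..d}. norm (v (a + h) - v a - h *\<^sub>R C (v a)) \<le> e' * h)"
    by (elim exE conjE)
  then have v: "\<And>a. a \<in> {0..\<tau>} \<Longrightarrow>
      (\<exists>p\<in>G. \<exists>q\<in>G. \<exists>\<theta>\<in>{0..1}. v a = (1 - \<theta>) *\<^sub>R p + \<theta> *\<^sub>R q)"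
      "\<And>a. a \<in> {0..\<tau>} \<Longrightarrow> norm (v a - ?T a f') \<le> e'"
      "\<And>a h. a \<in> {0..\<tau>} \<Longrightarrow> h \<in> {0..d} \<Longrightarrow> norm (v (a + h) - v a - h *\<^sub>R C (v a)) \<le> e' * h"
    by auto
  \<comment> \<open>This consistency error is linear in \<open>g\<close> on \<open>D\<close>, so
    bounds at the nodes in \<open>G\<close> pass to the convex combinations that make up the
    curve.\<close>
  define E where "E h s g = F h (s - h) (apply_c0 g (s - h)) - apply_c0 g s - h *\<^sub>R apply_c0 (C g) s" for h s g
  have "\<forall>g\<in>G. \<exists>d>0. \<forall>h\<in>{0..d}. \<forall>s. norm (E h s g) \<le> e' * h"
    unfolding E_def using consistent[OF _ e'] G(2) by blast
  then obtain c where c: "\<And>g. g \<in> G \<Longrightarrow> c g > 0"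
    "\<And>g h s. g \<in> G \<Longrightarrow> h \<in> {0..c g} \<Longrightarrow> norm (E h s g) \<le> e' * h"
    by metis
  define d' where "d' = Min (insert d (c ` G))"
  have d': "d' > 0" "d' \<le> d" "\<And>g. g \<in> G \<Longrightarrow> d' \<le> c g"
    using G(1) d c(1) by (auto simp: d'_def)
  \<comment> \<open>One \<open>e' * h\<close> is the consistency error at \<open>v a\<close>, the
    other the defect of the curve in the equation v' = C v.\<close>
  have step: "norm (F h (s - h) (v a (s - h)) - v (a + h) s) \<le> 2 * e' * h"
    if a: "a \<in> {0..\<tau>}" and h: "h \<in> {0..d'}" for a h s
  proof -
    obtain p q \<theta> where pq: "p \<in> G" "q \<in> G" and \<theta>: "0 \<le> \<theta>" "\<theta> \<le> 1"
      and va: "v a = (1 - \<theta>) *\<^sub>R p + \<theta> *\<^sub>R q" using v(1)[OF a] by auto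
    have Cv: "C (v a) = (1 - \<theta>) *\<^sub>R C p + \<theta> *\<^sub>R C q"
      unfolding va using pq G(2) by (intro linear_operator_linear_combination[OF lin]) auto
    have E: "E h s (v a) = (1 - \<theta>) *\<^sub>R E h s p + \<theta> *\<^sub>R E h s q - 0"
      unfolding E_def Cv by (simp add: va blinfun.add_right blinfun.diff_right blinfun.scaleR_right algebra_simps)
    have "norm (E h s p) \<le> e' * h" "norm (E h s q) \<le> e' * h"
      using c(2) pq h d'(3) by force+
    then have 1: "norm (E h s (v a)) \<le> e' * h"
      unfolding E using \<theta> by (intro norm_convex_combination_le) auto
    have "norm ((v (a + h) - v a - h *\<^sub>R C (v a)) s) \<le> e' * h"
      using v(3)[OF a, of h] h d'(2) norm_apply_c0_le order_trans by fastforce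
    then have 2: "norm (v (a + h) s - v a s - h *\<^sub>R C (v a) s) \<le> e' * h" by simp
    have "F h (s - h) (v a (s - h)) - v (a + h) s = E h s (v a) - (v (a + h) s - v a s - h *\<^sub>R C (v a) s)"
      by (simp add: E_def)
    also have "norm \<dots> \<le> e' * h + e' * h" by (intro norm_triangle_le_diff add_mono 1 2)
    finally show ?thesis by simp
  qed
  obtain N :: nat where N: "\<tau> / d' < real N" using reals_Archimedean2 by blast
  have "norm (prod_decreasing (\<lambda>p. F (t / real n) (s - real p * (t / real n))) n (f (s - t))
      - W s (s - t) (f (s - t))) \<le> e" if n: "n \<ge> Suc N" and t: "t \<in> {0..\<tau>}" for n t s
  proof -
    define h where "h = t / real n"
    have n0: "n > 0" using n by simp
    have nh: "real n * h = t" using n0 by (simp add: h_def)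
    have h0: "0 \<le> h" using t by (simp add: h_def)
    have "\<tau> / d' \<le> real n" using N n by linarith
    then have "h \<le> d'" using d'(1) n0 t by (auto simp: h_def field_simps)
    then have h: "h \<in> {0..d'}" using h0 by simp
    define V where "V = (\<lambda>p. F h (s - real p * h))"
    define P where "P = prod_decreasing V"
    \<comment> \<open>The curve is read backwards in time along the characteristic through
      \<open>s\<close>: \<open>u n = v 0 (s - t)\<close> is the start and \<open>u 0 = v t s\<close>
      the end.\<close>
    define u where "u k = v ((real n - real k) * h) (s - real k * h)" for k
    have kh: "real k * h \<le> t" if "k \<le> n" for k
      using that nh h0 mult_right_mono[of "real k" "real n" h] by simp
    have Pb: "norm (P k x) \<le> K * norm x" if "k \<le> n" for k x
      unfolding P_def V_def using kh[OF that] t h0 by (intro stab) auto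
    have summand: "norm (P k (V (Suc k) (u (Suc k)) - u k)) \<le> K * (2 * e' * h)" if k: "k < n" for k
    proof -
      let ?a = "(real n - real (Suc k)) * h"
      have "0 \<le> ?a" using k h0 by simp
      moreover have "?a \<le> t" using nh h0 by (simp add: algebra_simps)
      ultimately have "norm (F h (s - real k * h - h) (v ?a (s - real k * h - h)) - v (?a + h) (s - real k * h)) \<le> 2 * e' * h"
        using t by (intro step[OF _ h]) auto
      moreover have "s - real k * h - h = s - real (Suc k) * h" "?a + h = (real n - real k) * h"
        by (simp_all add: algebra_simps)
      ultimately have "norm (V (Suc k) (u (Suc k)) - u k) \<le> 2 * e' * h"
        by (simp add: V_def u_def)
      then show ?thesis using Pb[of k] k K by (meson less_imp_le mult_left_mono order_trans zero_le_one)
    qed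
    have "norm (P n (u n) - u 0) \<le> (\<Sum>k<n. K * (2 * e' * h))"
      unfolding P_def prod_decreasing_telescope unfolding P_def[symmetric]
      by (rule sum_norm_le) (use summand in simp)
    also have "\<dots> = 2 * K * e' * t" by (simp add: nh[symmetric])
    also have "\<dots> \<le> 2 * K * e' * \<tau>" using K e' t by (intro mult_left_mono) auto
    finally have main: "norm (P n (v 0 (s - t)) - v t s) \<le> 2 * K * e' * \<tau>"
      by (simp add: u_def nh)
    have small: "norm (g r) \<le> c" if "norm g \<le> c" for g :: "'a c0" and r c
      using norm_apply_c0_le[of g r] that by linarith
    have f'f: "norm (f - f') \<le> e'" using f' by (simp add: norm_minus_commute)
    have v0: "norm (f' - v 0) \<le> e'" using v(2)[of 0] \<tau> by (simp add: norm_minus_commute)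
    have 1: "norm (P n ((f - v 0) (s - t))) \<le> K * (2 * e')"
    proof -
      have "norm ((f - f') + (f' - v 0)) \<le> e' + e'"
        by (intro norm_triangle_le add_mono f'f v0)
      then have "norm (f - v 0) \<le> 2 * e'" by simp
      then show ?thesis using Pb[of n "(f - v 0) (s - t)"] small K
        by (meson mult_left_mono order_refl order_trans zero_le_one)
    qed
    have 2: "norm ((v t - ?T t f') s) \<le> e'" by (rule small[OF v(2)[OF t]])
    have 3: "norm (?T t (f' - f) s) \<le> K * e'"
      using Tb[of t "f' - f"] t f' K by (intro small order_trans[OF Tb mult_left_mono]) auto
    have "P n (f (s - t)) - ?T t f s = (P n (v 0 (s - t)) - v t s) + P n ((f - v 0) (s - t))
        + (v t - ?T t f') s + ?T t (f' - f) s"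
      by (simp add: blinfun.diff_right)
    also have "norm \<dots> \<le> 2 * K * e' * \<tau> + K * (2 * e') + e' + K * e'"
      by (intro norm_triangle_le add_mono main 1 2 3)
    also have "\<dots> \<le> 2 * K * e' * \<tau> + 8 * K * e'"
      using K e' mult_right_mono[of 1 K e'] by simp
    also have "\<dots> = e" by (rule e'e)
    finally show ?thesis
      using t by (simp add: P_def V_def h_def evolution_semigroup_apply[OF W])
  qed
  then show ?thesis by blast
qed

section \<open>The operator \<open>-d/ds + A(\<cdot>) + B(\<cdot>)\<close>\<close>

lemma deriv_op_apply: "f \<in> deriv_dom \<Longrightarrow> deriv_op f s = vector_derivative f (at s)"
  by (simp add: deriv_op_def deriv_dom_def apply_Abs_c0)

lemma deriv_op_has_vector_derivative:
  "f \<in> deriv_dom \<Longrightarrow> (apply_c0 f has_vector_derivative deriv_op f s) (at s)"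
  by (simp add: deriv_op_apply vector_derivative_works[symmetric]) (simp add: deriv_dom_def)

lemma deriv_domI:
  assumes "\<And>s. (apply_c0 f has_vector_derivative apply_c0 g s) (at s)"
  shows "f \<in> deriv_dom" "deriv_op f = g"
proof -
  have eq: "(\<lambda>s. vector_derivative f (at s)) = apply_c0 g"
    using assms by (auto simp: vector_derivative_at)
  show "f \<in> deriv_dom"
    using assms apply_c0[of g] by (auto simp: deriv_dom_def eq intro: differentiableI_vector)
  show "deriv_op f = g" by (simp add: deriv_op_def eq apply_c0_inverse)
qed

lemma mult_op_apply: "f \<in> mult_dom D A \<Longrightarrow> mult_op A f s = A s (f s)"
  by (simp add: mult_op_def mult_dom_def apply_Abs_c0)

lemma linear_operator_deriv: "linear_operator deriv_dom (deriv_op :: 'a::real_normed_vector c0 \<Rightarrow> _)"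
proof -
  have add: "f + g \<in> deriv_dom" "deriv_op (f + g) = deriv_op f + deriv_op g"
    if "f \<in> deriv_dom" "g \<in> deriv_dom" for f g :: "'a c0"
    using that by (auto intro!: deriv_domI[of "f + g" "deriv_op f + deriv_op g"]
        has_vector_derivative_add deriv_op_has_vector_derivative)
  have scale: "c *\<^sub>R f \<in> deriv_dom" "deriv_op (c *\<^sub>R f) = c *\<^sub>R deriv_op f"
    if "f \<in> deriv_dom" for f :: "'a c0" and c
    using that has_vector_derivative_scaleR[OF DERIV_const[of c] deriv_op_has_vector_derivative[OF that]]
    by (auto intro!: deriv_domI[of "c *\<^sub>R f" "c *\<^sub>R deriv_op f"])
  have "(0 :: 'a c0) \<in> deriv_dom" by (rule deriv_domI[of 0 0]) simp
  then show ?thesis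
    using add scale by (auto simp: linear_operator_def subspace_def)
qed

lemma linear_operator_mult:
  assumes lin: "\<And>s. linear_operator (D s) (A s)"
  shows "linear_operator (mult_dom D A) (mult_op A)"
proof -
  have A: "A s (x + y) = A s x + A s y" "x + y \<in> D s" if "x \<in> D s" "y \<in> D s" for s x y
    using lin[of s] that by (auto simp: linear_operator_def subspace_def)
  have A': "A s (c *\<^sub>R x) = c *\<^sub>R A s x" "c *\<^sub>R x \<in> D s" if "x \<in> D s" for s x c
    using lin[of s] that by (auto simp: linear_operator_def subspace_def)
  have zero: "0 \<in> D s" for s using lin[of s] by (simp add: linear_operator_def subspace_0)
  have A0: "A s 0 = 0" for s using A'(1)[OF zero, of s 0] by simp
  have add: "f + g \<in> mult_dom D A" if "f \<in> mult_dom D A" "g \<in> mult_dom D A" for f g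
    using that C0_add[of "\<lambda>s. A s (f s)" "\<lambda>s. A s (g s)"] by (simp add: mult_dom_def A)
  have scale: "c *\<^sub>R f \<in> mult_dom D A" if "f \<in> mult_dom D A" for f c
    using that C0_scaleR[of "\<lambda>s. A s (f s)" c] by (simp add: mult_dom_def A')
  have "0 \<in> mult_dom D A" by (simp add: mult_dom_def zero A0 C0_zero)
  moreover have "mult_op A (f + g) = mult_op A f + mult_op A g"
    if "f \<in> mult_dom D A" "g \<in> mult_dom D A" for f g
    using that by (intro c0_eqI) (simp add: mult_op_apply[OF add] mult_op_apply, simp add: mult_dom_def A)
  moreover have "mult_op A (c *\<^sub>R f) = c *\<^sub>R mult_op A f" if "f \<in> mult_dom D A" for f c
    using that by (intro c0_eqI) (simp add: mult_op_apply[OF scale] mult_op_apply, simp add: mult_dom_def A')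
  ultimately show ?thesis
    using add scale by (auto simp: linear_operator_def subspace_def)
qed

lemma linear_operator_minus_add_add:
  assumes "linear_operator D1 A1" "linear_operator D2 A2" "linear_operator D3 A3"
  shows "linear_operator (D1 \<inter> D2 \<inter> D3) (\<lambda>x. - A1 x + A2 x + A3 x)"
  using assms unfolding linear_operator_def
  by (auto simp: subspace_inter algebra_simps)

section \<open>Consistency of the splitting steps\<close>

text \<open>The orbit of \<open>g r\<close> has velocity \<open>S r t (mult_op A g r)\<close>. Since
  \<open>mult_op A g\<close> is again a function in C_0, this stays close to
  \<open>mult_op A g r\<close> for short times, uniformly in \<open>r\<close>.\<close>

lemma semigroup_family_consistent:
  fixes S :: "real \<Rightarrow> real \<Rightarrow> 'a::banach \<Rightarrow>\<^sub>L 'a" and g :: "'a c0"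
  assumes lin: "\<And>r. linear_operator (D r) (A r)"
    and gen: "\<And>r. generates (D r) (A r) (S r)"
    and bound: "\<And>r t. 0 \<le> t \<Longrightarrow> norm (S r t) \<le> M * exp (w * t)"
    and cont: "\<And>x. continuous_on UNIV (\<lambda>t. resolvent l (D t) (A t) x)" and l: "w < l"
    and g: "g \<in> mult_dom D A" and e: "e > 0"
  shows "\<exists>d>0. \<forall>h\<in>{0..d}. \<forall>r. norm (S r h (g r) - g r - h *\<^sub>R mult_op A g r) \<le> e * h"
proof -
  obtain d where d: "d > 0" "\<And>h r. h \<in> {0..d} \<Longrightarrow> norm (S r h (mult_op A g r) - mult_op A g r) \<le> e"
    using semigroup_family_uniformly_near_identity[OF lin gen bound cont l e, of "mult_op A g"] by auto
  have "norm (S r h (g r) - g r - h *\<^sub>R mult_op A g r) \<le> e * h" if h: "h \<in> {0..d}" for h r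
  proof -
    interpret S: exp_bounded_semigroup "S r" M w
      using gen bound by unfold_locales (auto simp: generates_def)
    have "(g r, mult_op A g r) \<in> op_graph (D r) (A r)"
      using g by (auto simp: mult_op_apply[OF g] op_graph_def mult_dom_def)
    then have "(g r, mult_op A g r) \<in> generator_graph (S r)"
      using gen by (simp add: generates_def)
    from S.orbit_increment_le[OF this, of 0 h] d(2)[of _ r] h show ?thesis by simp
  qed
  then show ?thesis using d(1) by blast
qed

lemma splitting_consistent:
  fixes SA SB :: "real \<Rightarrow> real \<Rightarrow> 'a::banach \<Rightarrow>\<^sub>L 'a" and g :: "'a c0"
  assumes lin_A: "\<And>r. linear_operator (DA r) (A r)" and lin_B: "\<And>r. linear_operator (DB r) (B r)"
    and gen_A: "\<And>r. generates (DA r) (A r) (SA r)" and gen_B: "\<And>r. generates (DB r) (B r) (SB r)"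
    and bound_A: "\<And>r t. 0 \<le> t \<Longrightarrow> norm (SA r t) \<le> M * exp (w * t)"
    and bound_B: "\<And>r t. 0 \<le> t \<Longrightarrow> norm (SB r t) \<le> M * exp (w * t)"
    and cont_A: "\<And>x. continuous_on UNIV (\<lambda>t. resolvent l (DA t) (A t) x)"
    and cont_B: "\<And>x. continuous_on UNIV (\<lambda>t. resolvent l (DB t) (B t) x)" and l: "w < l"
    and g: "g \<in> deriv_dom \<inter> mult_dom DA A \<inter> mult_dom DB B" and e: "e > 0"
  shows "\<exists>d>0. \<forall>h\<in>{0..d}. \<forall>s.
    norm ((SB (s - h) h o\<^sub>L SA (s - h) h) (g (s - h)) - g s
      - h *\<^sub>R (- deriv_op g + mult_op A g + mult_op B g) s) \<le> e * h"
proof -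
  have gd: "g \<in> deriv_dom" and gA: "g \<in> mult_dom DA A" and gB: "g \<in> mult_dom DB B"
    using g by auto
  let ?a = "mult_op A g" and ?b = "mult_op B g" and ?g' = "deriv_op g"
  define K where "K = M * exp \<bar>w\<bar> + 1"
  have "0 \<le> M" using bound_B[of 0 0] norm_ge_zero[of "SB 0 0"] by (simp del: norm_ge_zero)
  then have K: "K \<ge> 1" by (simp add: K_def)
  have Kb: "norm (SB r h x) \<le> K * norm x" if "0 \<le> h" "h \<le> 1" for r h x
  proof -
    have "w * h \<le> \<bar>w\<bar> * 1" using that by (intro mult_mono) auto
    then have "M * exp (w * h) \<le> M * exp \<bar>w\<bar>" using \<open>0 \<le> M\<close> by (intro mult_left_mono) auto
    then have "norm (SB r h) \<le> K" using bound_B[OF that(1), of r] by (simp add: K_def)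
    then show ?thesis by (intro order_trans[OF norm_blinfun] mult_right_mono) auto
  qed
  \<comment> \<open>Of the six error terms below, \<open>?t1\<close> passes through
    \<open>SB\<close> and costs \<open>K * (e' * h)\<close>; the other five cost
    \<open>e' * h\<close> each.\<close>
  define e' where "e' = e / (K + 5)"
  have e': "e' > 0" "(K + 5) * e' = e" using e K by (auto simp: e'_def)
  obtain d1 where d1: "d1 > 0"
    "\<And>h r. h \<in> {0..d1} \<Longrightarrow> norm (SA r h (g r) - g r - h *\<^sub>R ?a r) \<le> e' * h"
    using semigroup_family_consistent[OF lin_A gen_A bound_A cont_A l gA e'(1)] by blast
  obtain d2 where d2: "d2 > 0"
    "\<And>h r. h \<in> {0..d2} \<Longrightarrow> norm (SB r h (g r) - g r - h *\<^sub>R ?b r) \<le> e' * h"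
    using semigroup_family_consistent[OF lin_B gen_B bound_B cont_B l gB e'(1)] by blast
  \<comment> \<open>\<open>SB\<close> also acts on \<open>?a r\<close>, which need not lie in the
    domain of \<open>B r\<close>. Closeness to the identity is enough there, because the term
    carries a factor \<open>h\<close>.\<close>
  obtain d3 where d3: "d3 > 0" "\<And>h r. h \<in> {0..d3} \<Longrightarrow> norm (SB r h (?a r) - ?a r) \<le> e'"
    using semigroup_family_uniformly_near_identity[OF lin_B gen_B bound_B cont_B l e'(1)] by blast
  obtain d4 where d4: "d4 > 0" "\<And>h r. h \<in> {0..d4} \<Longrightarrow> norm (?a (r + h) - ?a r) \<le> e'"
    using c0_translation_continuous[OF e'(1)] by blast
  obtain d5 where d5: "d5 > 0" "\<And>h r. h \<in> {0..d5} \<Longrightarrow> norm (?b (r + h) - ?b r) \<le> e'"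
    using c0_translation_continuous[OF e'(1)] by blast
  obtain d6 where d6: "d6 > 0" "\<And>h r. h \<in> {0..d6} \<Longrightarrow> norm (?g' (r + h) - ?g' r) \<le> e'"
    using c0_translation_continuous[OF e'(1)] by blast
  define d where "d = Min {1, d1, d2, d3, d4, d5, d6}"
  have d: "d > 0" using d1(1) d2(1) d3(1) d4(1) d5(1) d6(1) by (simp add: d_def)
  have "norm ((SB (s - h) h o\<^sub>L SA (s - h) h) (g (s - h)) - g s - h *\<^sub>R (- ?g' + ?a + ?b) s) \<le> e * h"
    if "h \<in> {0..d}" for h s
  proof -
    define r where "r = s - h"
    have s: "s = r + h" by (simp add: r_def)
    have h: "0 \<le> h" "h \<le> 1" "h \<in> {0..d1}" "h \<in> {0..d2}" "h \<in> {0..d3}" "h \<in> {0..d4}" "h \<in> {0..d5}" "h \<le> d6"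
      using that by (auto simp: d_def)
    \<comment> \<open>\<open>?t1\<close> and \<open>?t3\<close> are the consistency errors of the
      two semigroups, \<open>?t2\<close> is the effect of \<open>SB\<close> on the increment made by
      \<open>SA\<close>, \<open>?t4\<close> expands \<open>g\<close> backwards from
      \<open>s\<close>, and \<open>?t5\<close>, \<open>?t6\<close> arise because the operators act
      at \<open>r\<close> while the limit is taken at \<open>s\<close>.\<close>
    let ?t1 = "SB r h (SA r h (g r) - g r - h *\<^sub>R ?a r)"
      and ?t2 = "h *\<^sub>R (SB r h (?a r) - ?a r)"
      and ?t3 = "SB r h (g r) - g r - h *\<^sub>R ?b r"
      and ?t4 = "g s - g r - (s - r) *\<^sub>R ?g' s"
      and ?t5 = "h *\<^sub>R (?a (r + h) - ?a r)" and ?t6 = "h *\<^sub>R (?b (r + h) - ?b r)"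
    have 1: "norm ?t1 \<le> K * (e' * h)"
      using d1(2)[OF h(3), of r] K by (intro order_trans[OF Kb[OF h(1,2)]] mult_left_mono) auto
    have 2: "norm ?t2 \<le> h * e'" using d3(2)[OF h(5), of r] h(1) by (simp add: mult_left_mono)
    have 3: "norm ?t3 \<le> e' * h" by (rule d2(2)[OF h(4)])
    have 4: "norm ?t4 \<le> e' * (s - r)"
    proof (rule vector_derivative_mean_value_ineq)
      fix q assume q: "r \<le> q" "q \<le> s"
      show "(apply_c0 g has_vector_derivative ?g' q) (at q within {r..s})"
        by (rule has_vector_derivative_at_within[OF deriv_op_has_vector_derivative[OF gd]])
      show "norm (?g' q - ?g' s) \<le> e'"
        using d6(2)[of "s - q" q] q h(8) by (auto simp: s norm_minus_commute)
    qed (use h s in auto)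
    have 5: "norm ?t5 \<le> h * e'" using d4(2)[OF h(6), of r] h(1) by (simp add: mult_left_mono)
    have 6: "norm ?t6 \<le> h * e'" using d5(2)[OF h(7), of r] h(1) by (simp add: mult_left_mono)
    have "(SB r h o\<^sub>L SA r h) (g r) - g s - h *\<^sub>R (- ?g' + ?a + ?b) s = ?t1 + ?t2 + ?t3 - ?t4 - ?t5 - ?t6"
      by (simp add: s blinfun.diff_right blinfun.add_right blinfun.scaleR_right algebra_simps)
    also have "norm \<dots> \<le> K * (e' * h) + h * e' + e' * h + e' * (s - r) + h * e' + h * e'"
      by (intro norm_triangle_le_diff norm_triangle_le add_mono 1 2 3 4 5 6)
    also have "\<dots> = ((K + 5) * e') * h" by (simp add: s algebra_simps)
    also have "\<dots> = e * h" by (simp only: e'(2))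
    finally show ?thesis by (simp only: r_def)
  qed
  then show ?thesis using d by blast
qed

section \<open>The splitting formula\<close>

lemma c0_constant_on_bounded_set:
  fixes x :: "'a::real_normed_vector"
  shows "\<exists>f :: 'a c0. \<forall>s. \<bar>s\<bar> \<le> R \<longrightarrow> f s = x"
proof -
  let ?\<phi> = "\<lambda>s. max 0 (min 1 (R + 1 - \<bar>s\<bar>))"
  have "\<forall>\<^sub>F s in at_infinity. ?\<phi> s *\<^sub>R x = 0"
    unfolding eventually_at_infinity by (intro exI[of _ "R + 1"]) auto
  then have "(\<lambda>s. ?\<phi> s *\<^sub>R x) \<in> C0"
    by (auto simp: C0_def tendsto_eventually intro!: continuous_intros)
  then show ?thesis
    by (intro exI[of _ "Abs_c0 (\<lambda>s. ?\<phi> s *\<^sub>R x)"]) (auto simp: apply_Abs_c0)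
qed

theorem theorem2p2:
  fixes DA DB :: "real \<Rightarrow> 'a::banach set"
    and A B :: "real \<Rightarrow> 'a \<Rightarrow> 'a"
    and W :: "real \<Rightarrow> real \<Rightarrow> 'a \<Rightarrow>\<^sub>L 'a"
    and SA SB :: "real \<Rightarrow> real \<Rightarrow> 'a \<Rightarrow>\<^sub>L 'a"
    and M \<omega> :: real
  assumes lin_A: "\<And>r. linear_operator (DA r) (A r)"
    and lin_B: "\<And>r. linear_operator (DB r) (B r)"
    and wp: "well_posed (\<lambda>r. DA r \<inter> DB r) (\<lambda>r x. A r x + B r x)"
    and W_ev: "evolution_family W"
    and W_solves: "solves_NCP W (\<lambda>r. DA r \<inter> DB r) (\<lambda>r x. A r x + B r x)"
    and W_gen: "generator_graph (evolution_semigroup W) =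
      closure (op_graph (deriv_dom \<inter> mult_dom DA A \<inter> mult_dom DB B)
                        (\<lambda>f. - deriv_op f + mult_op A f + mult_op B f))"
    and M: "1 \<le> M"
    and gen_A: "\<And>r. generates (DA r) (A r) (SA r)"
    and gen_B: "\<And>r. generates (DB r) (B r) (SB r)"
    and bound_A: "\<And>r t. 0 \<le> t \<Longrightarrow> norm (SA r t) \<le> M * exp (\<omega> * t)"
    and bound_B: "\<And>r t. 0 \<le> t \<Longrightarrow> norm (SB r t) \<le> M * exp (\<omega> * t)"
    and stable: "\<And>t n s. 0 \<le> t \<Longrightarrow> 1 \<le> n \<Longrightarrow>
      norm (prod_decreasing
        (\<lambda>p. SB (s - real p * t / real n) (t / real n) o\<^sub>L SA (s - real p * t / real n) (t / real n)) n)
      \<le> M * exp (\<omega> * t)"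
    and cont_A: "\<And>\<mu> x. \<omega> < \<mu> \<Longrightarrow> continuous_on UNIV (\<lambda>t. resolvent \<mu> (DA t) (A t) x)"
    and cont_B: "\<And>\<mu> x. \<omega> < \<mu> \<Longrightarrow> continuous_on UNIV (\<lambda>t. resolvent \<mu> (DB t) (B t) x)"
  shows "\<forall>x. \<forall>K. compact K \<and> K \<subseteq> {(t, s). s \<le> t} \<longrightarrow>
    uniform_limit K
      (\<lambda>n (t, s). prod_increasing
        (\<lambda>p. SB (s + real p * (t - s) / real n) ((t - s) / real n) o\<^sub>L
             SA (s + real p * (t - s) / real n) ((t - s) / real n)) n x)
      (\<lambda>(t, s). W t s x) sequentially"
proof (intro allI impI)
  fix x :: 'a and Q :: "(real \<times> real) set"
  assume Q: "compact Q \<and> Q \<subseteq> {(t, s). s \<le> t}"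
  define F where "F h r = SB r h o\<^sub>L SA r h" for h r
  let ?D = "deriv_dom \<inter> mult_dom DA A \<inter> mult_dom DB B"
  let ?C = "\<lambda>f. - deriv_op f + mult_op A f + mult_op B f"
  have l: "\<omega> < \<omega> + 1" by simp
  have lin: "linear_operator ?D ?C"
    by (intro linear_operator_minus_add_add linear_operator_deriv linear_operator_mult lin_A lin_B)
  have stab: "norm (prod_decreasing (\<lambda>p. F h (s - real p * h)) n) \<le> M * exp (\<omega> * (real n * h))"
    if "0 \<le> h" for h n s
  \<comment> \<open>Telescoping includes the empty product, which \<open>stable\<close> does not
    cover; its norm is at most \<open>1 \<le> M\<close>.\<close>
  proof (cases "n = 0")
    case True
    then show ?thesis using norm_blinfun_id_le M order_trans by fastforce
  next
    case False
    then show ?thesis using stable[of "real n * h" n s] that by (simp add: F_def)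
  qed
  have cons: "\<exists>d>0. \<forall>h\<in>{0..d}. \<forall>s. norm (F h (s - h) (g (s - h)) - g s - h *\<^sub>R ?C g s) \<le> e * h"
    if "g \<in> ?D" "e > 0" for g e
    unfolding F_def
    by (rule splitting_consistent[OF lin_A lin_B gen_A gen_B bound_A bound_B cont_A[OF l] cont_B[OF l] l that])
  obtain R where R: "\<And>t s. (t, s) \<in> Q \<Longrightarrow> \<bar>t\<bar> \<le> R \<and> \<bar>s\<bar> \<le> R"
  proof -
    have "bounded Q" using Q compact_imp_bounded by blast
    then obtain R where R: "\<And>p. p \<in> Q \<Longrightarrow> norm p \<le> R"
      unfolding bounded_iff by blast
    have "\<bar>t\<bar> \<le> R \<and> \<bar>s\<bar> \<le> R" if "(t, s) \<in> Q" for t s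
      using R[OF that] norm_fst_le[of t s] norm_snd_le[of s t] by simp
    then show thesis by (rule that)
  qed
  obtain f :: "'a c0" where f: "\<And>s. \<bar>s\<bar> \<le> R \<Longrightarrow> f s = x"
    using c0_constant_on_bounded_set by blast
  show "uniform_limit Q
      (\<lambda>n (t, s). prod_increasing
        (\<lambda>p. SB (s + real p * (t - s) / real n) ((t - s) / real n) o\<^sub>L
             SA (s + real p * (t - s) / real n) ((t - s) / real n)) n x)
      (\<lambda>(t, s). W t s x) sequentially"
  proof (rule uniform_limitI)
    fix e :: real assume e: "e > 0"
    \<comment> \<open>On \<open>Q\<close> the elapsed time \<open>t - s\<close> is at most
      \<open>2 * R\<close>. The absolute value matters when \<open>Q\<close> is empty, where
      \<open>R\<close> may be negative.\<close>
    have "\<exists>N. \<forall>n\<ge>N. \<forall>t\<in>{0..2 * \<bar>R\<bar>}. \<forall>s.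
        norm (prod_decreasing (\<lambda>p. F (t / real n) (s - real p * (t / real n))) n (f (s - t))
          - W s (s - t) (f (s - t))) \<le> e / 2"
      by (rule chernoff_evolution_family[OF W_ev equalityD1[OF W_gen] lin stab cons]) (use e in auto)
    then obtain N where N: "\<And>n t s. n \<ge> N \<Longrightarrow> t \<in> {0..2 * \<bar>R\<bar>} \<Longrightarrow>
        norm (prod_decreasing (\<lambda>p. F (t / real n) (s - real p * (t / real n))) n (f (s - t))
          - W s (s - t) (f (s - t))) \<le> e / 2" by blast
    show "\<forall>\<^sub>F n in sequentially. \<forall>p\<in>Q. dist ((\<lambda>(t, s). prod_increasing
        (\<lambda>p. SB (s + real p * (t - s) / real n) ((t - s) / real n) o\<^sub>L
             SA (s + real p * (t - s) / real n) ((t - s) / real n)) n x) p)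
      ((\<lambda>(t, s). W t s x) p) < e"
    proof (intro eventually_sequentiallyI[of "Suc N"] ballI, clarsimp)
      fix n t s assume n: "Suc N \<le> n" and ts: "(t, s) \<in> Q"
      \<comment> \<open>The estimate is applied at the final time \<open>t\<close> with elapsed time
        \<open>t - s\<close>, so that \<open>f\<close> is evaluated at \<open>s\<close>, where it
        equals \<open>x\<close>. Counting the nodes from the end turns \<open>s + (n - p) h\<close>
        into \<open>t - p h\<close> for h = (t - s)/n.\<close>
      have "prod_increasing (\<lambda>p. SB (s + real p * (t - s) / real n) ((t - s) / real n) o\<^sub>L
             SA (s + real p * (t - s) / real n) ((t - s) / real n)) n
          = prod_decreasing (\<lambda>p. F ((t - s) / real n) (t - real p * ((t - s) / real n))) n"
        unfolding prod_increasing_eq_decreasing F_def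
      proof (rule prod_decreasing_cong)
        fix p assume "1 \<le> p" "p \<le> n"
        then have "s + real (n - p) * (t - s) / real n = t - real p * ((t - s) / real n)"
          using n by (simp add: of_nat_diff field_simps)
        then show "SB (s + real (n - p) * (t - s) / real n) ((t - s) / real n) o\<^sub>L
            SA (s + real (n - p) * (t - s) / real n) ((t - s) / real n)
          = SB (t - real p * ((t - s) / real n)) ((t - s) / real n) o\<^sub>L
            SA (t - real p * ((t - s) / real n)) ((t - s) / real n)" by simp
      qed
      moreover have "t - s \<in> {0..2 * \<bar>R\<bar>}" using R[OF ts] Q ts by auto
      moreover have "f s = x" using R[OF ts] f by simp
      ultimately show "dist (prod_increasing (\<lambda>p. SB (s + real p * (t - s) / real n) ((t - s) / real n) o\<^sub>L
             SA (s + real p * (t - s) / real n) ((t - s) / real n)) n x) (W t s x) < e"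
        using N[of n "t - s" t] n e by (simp add: dist_norm)
    qed
  qed
qed

end
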